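(* Let $\mathcal{A}$ be a unital $*$-algebra and let $Z$ be a linear hermitian functional on $\mathcal{A}$ with $Z(1)=1$. Then $Z$ admits bounded GNS data if and only if there exists a positive definite scalar kernel $L$ on $\mathcal{A}$ having the property $$\Big|Z\Big(\sum_{i,j=1}^n\lambda_i\overline{\lambda}_j x_ix_j^*\Big)\Big|\le\sum_{i,j=1}^n\lambda_i\overline{\lambda}_jL(x_i,x_j),\quad n\in\mathbb{N},\ \{\lambda_i\}_{i=1}^n\subset\mathbb{C},\ \{x_i\}_{i=1}^n\subset\mathcal{A},$$ and such that for every $a\in\mathcal{A}$ there exists $C_a>0$ with the property that $$\sum_{i,j=1}^n\lambda_i\overline{\lambda}_jL(x_ia^*,x_ja^* )\le C_a\sum_{i,j=1}^n\lambda_i\overline{\lambda}_jL(x_i,x_j),\quad n\in\mathbb{N},\ \{\lambda_i\}_{i=1}^n\subset\mathbb{C},\ \{x_i\}_{i=1}^n\subset\mathcal{A}.$$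
   Context: $\mathcal{A}$ is a complex $*$-algebra with identity $1$; $Z$ is hermitian if $Z(a^* )=\overline{Z(a)}$. A scalar kernel $L:\mathcal{A}\times\mathcal{A}\to\mathbb{C}$ is positive definite if it is hermitian ($L(x,y)=\overline{L(y,x)}$) and $\sum_{i,j}L(x_i,x_j)\lambda_j\overline{\lambda_i}\ge0$ for all finite families. A Kreĭn space is an indefinite inner product space $(\mathcal{K},[\cdot,\cdot])$ for which there is a positive inner product $\langle\cdot,\cdot\rangle$ turning $\mathcal{K}$ into a Hilbert space, and $J=J^*=J^{-1}$ on $\mathcal{K}$, with $[\xi,\eta]=\langle J\xi,\eta\rangle$; $\sharp$ denotes the adjoint with respect to $[\cdot,\cdot]$, and boundedness refers to the Hilbert space norm (its topology does not depend on the choice of $J$). A closable representation $\pi$ of $\mathcal{A}$ on $\mathcal{K}$ is a linear mapping of $\mathcal{A}$ into the closable operators defined on a common dense domain $\mathcal{D}(\pi)$ of $\mathcal{K}$, with $\mathcal{D}(\pi)$ invariant under all $\pi(a)$ and $\pi(ab)=\pi(a)\pi(b)$. It is hermitian if for all $a$ the domain of $\pi(a)^\sharp$ contains $\mathcal{D}(\pi)$ and $\pi(a)^\sharp|\mathcal{D}(\pi)=\pi(a^* )$. GNS data $(\pi,\mathcal{K},\Omega)$ of $Z$ consist of a hermitian closable representation $\pi$ on a Kreĭn space $\mathcal{K}$ and $\Omega\in\mathcal{D}(\pi)$ with $Z(a)=[\pi(a)\Omega,\Omega]_{\mathcal{K}}$ for all $a\in\mathcal{A}$ and $\bigvee_{a}\pi(a)\Omega=\mathcal{D}(\pi)$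 ($\bigvee$ = linear span without closure). GNS data are bounded if every operator $\pi(a)$ is bounded. *)

theory Defs
  imports
    "HOL-Analysis.Analysis"
    "HOL-Library.Function_Algebras"
    "HOL-Library.Complex_Order"
begin

section \<open>Unital complex \<open>*\<close>-algebras and kernels\<close>

locale complex_star_algebra = vector_space scaleA
  for scaleA :: "complex \<Rightarrow> 'a::ring_1 \<Rightarrow> 'a" +
  fixes star :: "'a \<Rightarrow> 'a"
  assumes mult_scale_left: "scaleA c x * y = scaleA c (x * y)"
    and mult_scale_right: "x * scaleA c y = scaleA c (x * y)"
    and star_add: "star (x + y) = star x + star y"
    and star_scale: "star (scaleA c x) = scaleA (cnj c) (star x)"
    and star_mult: "star (x * y) = star y * star x"
    and star_star: "star (star x) = x"

definition hermitian_functional :: "('a \<Rightarrow> 'a) \<Rightarrow> ('a \<Rightarrow> complex) \<Rightarrow> bool" where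
  "hermitian_functional star Z \<longleftrightarrow> (\<forall>a. Z (star a) = cnj (Z a))"

text \<open>
  Inequalities between complex numbers use the order of \<^theory>\<open>HOL-Library.Complex_Order\<close>:
  \<open>z \<le> w\<close> means that \<open>w - z\<close> is real and nonnegative.
\<close>

definition positive_definite_kernel :: "('a \<Rightarrow> 'a \<Rightarrow> complex) \<Rightarrow> bool" where
  "positive_definite_kernel L \<longleftrightarrow>
    (\<forall>x y. L x y = cnj (L y x)) \<and>
    (\<forall>(n::nat) (c :: nat \<Rightarrow> complex) (x :: nat \<Rightarrow> 'a).
       0 \<le> (\<Sum>i=1..n. \<Sum>j=1..n. L (x i) (x j) * c j * cnj (c i)))"


section \<open>Krein spaces\<close>

text \<open>
  Spaces are linear subspaces \<open>K\<close> of an ambient complex vector space given by \<open>scale\<close>.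
  Forms are linear in the first variable; their values outside \<open>K\<close> are irrelevant.
\<close>

locale hermitian_form = vector_space scale
  for scale :: "complex \<Rightarrow> 'v::ab_group_add \<Rightarrow> 'v" +
  fixes K :: "'v set" and form :: "'v \<Rightarrow> 'v \<Rightarrow> complex"
  assumes subspace_K: "subspace K"
    and form_add_left: "\<lbrakk>x \<in> K; y \<in> K; z \<in> K\<rbrakk> \<Longrightarrow> form (x + y) z = form x z + form y z"
    and form_scale_left: "\<lbrakk>x \<in> K; z \<in> K\<rbrakk> \<Longrightarrow> form (scale c x) z = c * form x z"
    and form_cnj: "\<lbrakk>x \<in> K; y \<in> K\<rbrakk> \<Longrightarrow> form x y = cnj (form y x)"

definition form_norm :: "('v \<Rightarrow> 'v \<Rightarrow> complex) \<Rightarrow> 'v \<Rightarrow> real" where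
  "form_norm ip x = sqrt (Re (ip x x))"

text \<open>
  The axioms of \<^locale>\<open>Metric_space\<close> ask for a nonnegative symmetric distance also outside
  the carrier; hence the case distinction.
\<close>

definition form_dist :: "'v::ab_group_add set \<Rightarrow> ('v \<Rightarrow> 'v \<Rightarrow> complex) \<Rightarrow> 'v \<Rightarrow> 'v \<Rightarrow> real" where
  "form_dist K ip x y = (if x \<in> K \<and> y \<in> K then form_norm ip (x - y) else 0)"

definition form_topology :: "'v::ab_group_add set \<Rightarrow> ('v \<Rightarrow> 'v \<Rightarrow> complex) \<Rightarrow> 'v topology" where
  "form_topology K ip = Metric_space.mtopology K (form_dist K ip)"

locale hilbert_space = hermitian_form scale K ip
  for scale :: "complex \<Rightarrow> 'v::ab_group_add \<Rightarrow> 'v" and K ip +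
  assumes ip_nonneg: "x \<in> K \<Longrightarrow> 0 \<le> ip x x"
    and ip_definite: "\<lbrakk>x \<in> K; ip x x = 0\<rbrakk> \<Longrightarrow> x = 0"
    and complete: "Metric_space.mcomplete K (form_dist K ip)"

text \<open>
  A Krein space \<open>(K, kf)\<close> together with a positive inner product \<open>ip\<close> and a symmetry \<open>J\<close>
  witnessing that it is one.  Norm and topology are those of \<open>ip\<close>; another choice
  of \<open>ip\<close> and \<open>J\<close> gives an equivalent norm.
\<close>

locale krein_space = hermitian_form scale K kf + pos: hilbert_space scale K ip
  for scale :: "complex \<Rightarrow> 'v::ab_group_add \<Rightarrow> 'v"
    and K :: "'v set" and kf ip :: "'v \<Rightarrow> 'v \<Rightarrow> complex" +
  fixes J :: "'v \<Rightarrow> 'v"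
  assumes J_closed: "x \<in> K \<Longrightarrow> J x \<in> K"
    and J_add: "\<lbrakk>x \<in> K; y \<in> K\<rbrakk> \<Longrightarrow> J (x + y) = J x + J y"
    and J_scale: "x \<in> K \<Longrightarrow> J (scale c x) = scale c (J x)"
    and J_selfadjoint: "\<lbrakk>x \<in> K; y \<in> K\<rbrakk> \<Longrightarrow> ip (J x) y = ip x (J y)"
    and J_involution: "x \<in> K \<Longrightarrow> J (J x) = x"
    and kf_eq: "\<lbrakk>x \<in> K; y \<in> K\<rbrakk> \<Longrightarrow> kf x y = ip (J x) y"


section \<open>Unbounded operators\<close>

text \<open>An operator with domain \<open>D\<close> is a function of which only the values on \<open>D\<close> matter.\<close>

definition closable_operator ::
    "'v::ab_group_add set \<Rightarrow> ('v \<Rightarrow> 'v \<Rightarrow> complex) \<Rightarrow> 'v set \<Rightarrow> ('v \<Rightarrow> 'v) \<Rightarrow> bool" where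
  "closable_operator K ip D T \<longleftrightarrow>
    single_valued
      (prod_topology (form_topology K ip) (form_topology K ip) closure_of {(x, T x) |x. x \<in> D})"

definition bounded_operator ::
    "('v \<Rightarrow> 'v \<Rightarrow> complex) \<Rightarrow> 'v set \<Rightarrow> ('v \<Rightarrow> 'v) \<Rightarrow> bool" where
  "bounded_operator ip D T \<longleftrightarrow> (\<exists>C. \<forall>x\<in>D. form_norm ip (T x) \<le> C * form_norm ip x)"

definition krein_adjoint_rel ::
    "'v set \<Rightarrow> ('v \<Rightarrow> 'v \<Rightarrow> complex) \<Rightarrow> 'v set \<Rightarrow> ('v \<Rightarrow> 'v) \<Rightarrow> 'v \<Rightarrow> 'v \<Rightarrow> bool" where
  "krein_adjoint_rel K kf D T y z \<longleftrightarrow> y \<in> K \<and> z \<in> K \<and> (\<forall>x\<in>D. kf (T x) y = kf x z)"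

definition krein_adjoint_dom ::
    "'v set \<Rightarrow> ('v \<Rightarrow> 'v \<Rightarrow> complex) \<Rightarrow> 'v set \<Rightarrow> ('v \<Rightarrow> 'v) \<Rightarrow> 'v set" where
  "krein_adjoint_dom K kf D T = {y. \<exists>z. krein_adjoint_rel K kf D T y z}"

text \<open>The description is unique because \<open>D\<close> is dense wherever the adjoint is used.\<close>

definition krein_adjoint ::
    "'v set \<Rightarrow> ('v \<Rightarrow> 'v \<Rightarrow> complex) \<Rightarrow> 'v set \<Rightarrow> ('v \<Rightarrow> 'v) \<Rightarrow> 'v \<Rightarrow> 'v" where
  "krein_adjoint K kf D T y = (THE z. krein_adjoint_rel K kf D T y z)"


section \<open>Representations and GNS data\<close>

locale closable_representation =
  alg: complex_star_algebra scaleA star + krein_space scale K kf ip J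
  for scaleA :: "complex \<Rightarrow> 'a::ring_1 \<Rightarrow> 'a" and star :: "'a \<Rightarrow> 'a"
    and scale :: "complex \<Rightarrow> 'v::ab_group_add \<Rightarrow> 'v" and K kf ip J +
  fixes D :: "'v set" and rep :: "'a \<Rightarrow> 'v \<Rightarrow> 'v"
  assumes subspace_D: "subspace D"
    and D_subset: "D \<subseteq> K"
    and D_dense: "form_topology K ip closure_of D = K"
    and rep_closed: "x \<in> D \<Longrightarrow> rep a x \<in> D"
    and rep_op_add: "\<lbrakk>x \<in> D; y \<in> D\<rbrakk> \<Longrightarrow> rep a (x + y) = rep a x + rep a y"
    and rep_op_scale: "x \<in> D \<Longrightarrow> rep a (scale c x) = scale c (rep a x)"
    and rep_closable: "closable_operator K ip D (rep a)"
    and rep_add: "x \<in> D \<Longrightarrow> rep (a + b) x = rep a x + rep b x"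
    and rep_scale: "x \<in> D \<Longrightarrow> rep (scaleA c a) x = scale c (rep a x)"
    and rep_mult: "x \<in> D \<Longrightarrow> rep (a * b) x = rep a (rep b x)"

locale hermitian_representation = closable_representation +
  assumes adjoint_dom_rep: "D \<subseteq> krein_adjoint_dom K kf D (rep a)"
    and adjoint_rep: "x \<in> D \<Longrightarrow> krein_adjoint K kf D (rep a) x = rep (star a) x"

locale gns_data = hermitian_representation +
  fixes Z :: "'a::ring_1 \<Rightarrow> complex" and \<Omega> :: "'b::ab_group_add"
  assumes \<Omega>_in_D: "\<Omega> \<in> D"
    and Z_eq: "Z a = kf (rep a \<Omega>) \<Omega>"
    and span_eq: "span (range (\<lambda>a. rep a \<Omega>)) = D"

locale bounded_gns_data = gns_data +
  assumes rep_bounded: "bounded_operator ip D (rep a)"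

text \<open>
  HOL cannot quantify over the type of the vectors of the Krein space.  Bounded GNS data over any
  type can be moved into the function space \<open>'a \<Rightarrow> complex\<close> by \<open>x \<mapsto> (\<lambda>a. kf x (rep a \<Omega>))\<close>, so this
  type is large enough; see \<open>admits_bounded_gns_dataI\<close> below.
\<close>

definition scale_fun :: "complex \<Rightarrow> ('a \<Rightarrow> complex) \<Rightarrow> 'a \<Rightarrow> complex" where
  "scale_fun c f = (\<lambda>a. c * f a)"

definition admits_bounded_gns_data ::
    "(complex \<Rightarrow> 'a::ring_1 \<Rightarrow> 'a) \<Rightarrow> ('a \<Rightarrow> 'a) \<Rightarrow> ('a \<Rightarrow> complex) \<Rightarrow> bool" where
  "admits_bounded_gns_data scaleA star Z \<longleftrightarrow>
    (\<exists>(K :: ('a \<Rightarrow> complex) set) kf ip J D rep \<Omega>.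
       bounded_gns_data scaleA star scale_fun K kf ip J D rep Z \<Omega>)"


section \<open>Independence of the type of vectors\<close>

context hermitian_form begin

lemma form_add_right:
  assumes "x \<in> K" "y \<in> K" "z \<in> K" shows "form z (x + y) = form z x + form z y"
proof -
  have "x + y \<in> K" using assms subspace_K by (simp add: subspace_add)
  then have "form z (x + y) = cnj (form (x + y) z)" using assms form_cnj by blast
  also have "\<dots> = cnj (form x z) + cnj (form y z)" using assms by (simp add: form_add_left)
  finally show ?thesis using assms form_cnj by metis
qed

lemma form_scale_right:
  assumes "x \<in> K" "z \<in> K" shows "form z (scale c x) = cnj c * form z x"
proof -
  have "scale c x \<in> K" using assms subspace_K by (simp add: subspace_scale)
  then have "form z (scale c x) = cnj (form (scale c x) z)" using assms form_cnj by blast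
  also have "\<dots> = cnj c * cnj (form x z)" using assms by (simp add: form_scale_left)
  finally show ?thesis using assms form_cnj by metis
qed

lemma minus_in: "x \<in> K \<Longrightarrow> y \<in> K \<Longrightarrow> x - y \<in> K"
  using subspace_K by (simp add: subspace_diff)

lemma form_diff_left:
  assumes "x \<in> K" "y \<in> K" "z \<in> K" shows "form (x - y) z = form x z - form y z"
  using form_add_left[of "x - y" y z] assms minus_in by simp

lemma form_diff_right:
  assumes "x \<in> K" "y \<in> K" "z \<in> K" shows "form z (x - y) = form z x - form z y"
  using form_add_right[of "x - y" y z] assms minus_in by simp

lemma zero_in: "0 \<in> K" using subspace_K by (simp add: subspace_0)

lemma form_zero: "x \<in> K \<Longrightarrow> form 0 x = 0" "x \<in> K \<Longrightarrow> form x 0 = 0"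
  using form_diff_left[of 0 0 x] form_diff_right[of 0 0 x] zero_in by simp_all

end

context hilbert_space begin

lemma ip_real: assumes "x \<in> K" shows "ip x x = complex_of_real ((form_norm ip x)\<^sup>2)" "0 \<le> form_norm ip x"
  using ip_nonneg[OF assms] by (auto simp: form_norm_def complex_eq_iff less_eq_complex_def)

lemma cauchy_schwarz:
  assumes "x \<in> K" "y \<in> K" shows "cmod (ip x y) \<le> form_norm ip x * form_norm ip y"
proof (cases "y = 0")
  case True then show ?thesis using assms ip_real(2)[of x] ip_real(2)[of y] by (simp add: form_zero)
next
  case False
  then have ny: "form_norm ip y \<noteq> 0" using ip_definite ip_real assms by fastforce
  define N where "N = (form_norm ip y)\<^sup>2"
  have N0: "N > 0" using ny by (simp add: N_def)
  define c where "c = ip x y / complex_of_real N"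
  have cy: "scale c y \<in> K" using assms subspace_K by (simp add: subspace_scale)
  have "0 \<le> ip (x - scale c y) (x - scale c y)" using assms cy minus_in ip_nonneg by blast
  also have "\<dots> = ip x x - cnj c * ip x y - c * ip y x + c * cnj c * ip y y"
    using assms cy minus_in
    by (simp add: form_diff_left form_diff_right form_scale_left form_scale_right algebra_simps)
  also have "\<dots> = complex_of_real ((form_norm ip x)\<^sup>2) - ip x y * cnj (ip x y) / N"
    using N0 form_cnj[OF assms(2,1)] ip_real(1)[OF assms(1)] ip_real(1)[OF assms(2)]
    by (simp add: c_def N_def[symmetric] field_simps)
  also have "\<dots> = complex_of_real ((form_norm ip x)\<^sup>2 - (cmod (ip x y))\<^sup>2 / N)"
    by (simp add: complex_norm_square[symmetric])
  finally have "(cmod (ip x y))\<^sup>2 / N \<le> (form_norm ip x)\<^sup>2" by (simp add: less_eq_complex_def)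
  then have "(cmod (ip x y))\<^sup>2 \<le> (form_norm ip x * form_norm ip y)\<^sup>2"
    using N0 by (simp add: N_def power_mult_distrib field_simps)
  then show ?thesis
    using ip_real(2)[OF assms(1)] ip_real(2)[OF assms(2)] power2_le_imp_le by fastforce
qed

lemma form_norm_triangle:
  assumes "x \<in> K" "y \<in> K" shows "form_norm ip (x + y) \<le> form_norm ip x + form_norm ip y"
proof -
  have xy: "x + y \<in> K" using assms subspace_K by (simp add: subspace_add)
  have "complex_of_real ((form_norm ip (x + y))\<^sup>2) = ip x x + ip y y + (ip x y + cnj (ip x y))"
    using assms xy form_cnj[OF assms(2,1)]
    by (simp add: ip_real(1)[symmetric] form_add_left form_add_right del: of_real_power)
  also have "\<dots> = complex_of_real ((form_norm ip x)\<^sup>2 + (form_norm ip y)\<^sup>2 + 2 * Re (ip x y))"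
    using assms by (simp add: ip_real(1) complex_add_cnj)
  finally have "(form_norm ip (x + y))\<^sup>2 = (form_norm ip x)\<^sup>2 + (form_norm ip y)\<^sup>2 + 2 * Re (ip x y)"
    using of_real_eq_iff by blast
  also have "\<dots> \<le> (form_norm ip x + form_norm ip y)\<^sup>2"
    using cauchy_schwarz[OF assms] complex_Re_le_cmod[of "ip x y"] by (simp add: power2_sum)
  finally show ?thesis
    using ip_real(2)[OF assms(1)] ip_real(2)[OF assms(2)] power2_le_imp_le by fastforce
qed

lemma metric_space: "Metric_space K (form_dist K ip)"
proof
  fix x y z
  show "0 \<le> form_dist K ip x y"
    using ip_real(2) minus_in by (simp add: form_dist_def)
  show "form_dist K ip x y = form_dist K ip y x"
    by (simp add: form_dist_def form_norm_def form_diff_left form_diff_right minus_in algebra_simps)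
  show "form_dist K ip x y = 0 \<longleftrightarrow> x = y" if "x \<in> K" "y \<in> K"
  proof
    assume "form_dist K ip x y = 0"
    then have "ip (x - y) (x - y) = 0" using that ip_real(1) minus_in by (simp add: form_dist_def)
    then show "x = y" using ip_definite minus_in that by fastforce
  qed (use that in \<open>simp add: form_dist_def form_norm_def form_zero zero_in\<close>)
  show "form_dist K ip x z \<le> form_dist K ip x y + form_dist K ip y z" if "x \<in> K" "y \<in> K" "z \<in> K"
    using form_norm_triangle[of "x - y" "y - z"] that minus_in by (simp add: form_dist_def)
qed

end

sublocale hilbert_space \<subseteq> Met: Metric_space K "form_dist K ip" by (rule metric_space)

context hilbert_space begin

lemma form_topology_eq: "form_topology K ip = Met.mtopology"
  by (simp add: form_topology_def)

end


context closable_representation begin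

lemma separated_by_D:
  assumes "x \<in> K" "\<And>y. y \<in> D \<Longrightarrow> kf x y = 0"
  shows "x = 0"
proof (rule ccontr)
  assume "x \<noteq> 0"
  let ?u = "J x"
  have u: "?u \<in> K" using assms J_closed by blast
  have "?u \<noteq> 0"
    using J_involution[OF assms(1)] J_scale[OF zero_in, of 0] J_scale[OF u, of 0] \<open>x \<noteq> 0\<close> by auto
  then have n: "form_norm ip ?u > 0"
    using u pos.ip_definite pos.ip_real[OF u] by (cases "form_norm ip ?u = 0") auto
  have "?u \<in> pos.Met.mtopology closure_of D" using D_dense u by (simp add: pos.form_topology_eq)
  then obtain d where d: "d \<in> D" "form_dist K ip ?u d < form_norm ip ?u"
    using n by (auto simp: pos.Met.metric_closure_of)
  have dK: "d \<in> K" using d D_subset by blast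
  have "ip ?u d = 0" using assms kf_eq d dK by metis
  then have "ip ?u ?u = ip ?u (?u - d)" using pos.form_diff_right u dK by simp
  then have "(form_norm ip ?u)\<^sup>2 \<le> form_norm ip ?u * form_norm ip (?u - d)"
    using pos.cauchy_schwarz[OF u minus_in[OF u dK]] pos.ip_real[OF u]
    by (metis abs_of_nonneg norm_of_real zero_le_power2)
  then show False using d n u dK by (simp add: form_dist_def power2_eq_square)
qed

end

lemma vector_space_scale_fun: "vector_space scale_fun"
  by unfold_locales (auto simp: scale_fun_def fun_eq_iff algebra_simps)

context bounded_gns_data begin

text \<open>\<open>emb\<close> is injective on \<open>K\<close> because \<open>D\<close> is dense and \<open>kf\<close> is nondegenerate.\<close>

definition emb :: "'b \<Rightarrow> 'a \<Rightarrow> complex" where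
  "emb x = (\<lambda>a. kf x (rep a \<Omega>))"

definition pull :: "('a \<Rightarrow> complex) \<Rightarrow> 'b" where "pull = inv_into K emb"

abbreviation "K' \<equiv> emb ` K"
abbreviation "D' \<equiv> emb ` D"
abbreviation "kf' \<equiv> \<lambda>f g. kf (pull f) (pull g)"
abbreviation "ip' \<equiv> \<lambda>f g. ip (pull f) (pull g)"
abbreviation "J' \<equiv> \<lambda>f. emb (J (pull f))"
abbreviation "rep' \<equiv> \<lambda>a f. emb (rep a (pull f))"

lemma DK: "x \<in> D \<Longrightarrow> x \<in> K" using D_subset by blast

lemma rep_\<Omega>: "rep a \<Omega> \<in> D" "rep a \<Omega> \<in> K" using rep_closed[OF \<Omega>_in_D] DK by auto

lemma emb_add: "x \<in> K \<Longrightarrow> y \<in> K \<Longrightarrow> emb (x + y) = emb x + emb y"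
  by (auto simp: emb_def fun_eq_iff form_add_left rep_\<Omega>)

lemma emb_scale: "x \<in> K \<Longrightarrow> emb (scale c x) = scale_fun c (emb x)"
  by (auto simp: emb_def fun_eq_iff form_scale_left rep_\<Omega> scale_fun_def)

lemma K_ops: "x \<in> K \<Longrightarrow> y \<in> K \<Longrightarrow> x + y \<in> K" "x \<in> K \<Longrightarrow> scale c x \<in> K"
  using subspace_K by (auto simp: subspace_add subspace_scale)

lemma D_ops: "x \<in> D \<Longrightarrow> y \<in> D \<Longrightarrow> x + y \<in> D" "x \<in> D \<Longrightarrow> scale c x \<in> D" "0 \<in> D"
  using subspace_D by (auto simp: subspace_add subspace_scale subspace_0)

lemma emb_diff: "x \<in> K \<Longrightarrow> y \<in> K \<Longrightarrow> emb (x - y) = emb x - emb y"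
  by (auto simp: emb_def fun_eq_iff form_diff_left rep_\<Omega>)

lemma emb_0: "emb 0 = 0"
  using emb_diff[of 0 0] zero_in by simp

lemma emb_eq_0: assumes "x \<in> K" "emb x = 0" shows "x = 0"
proof (rule separated_by_D[OF assms(1)])
  fix y assume "y \<in> D"
  then have "y \<in> span (range (\<lambda>a. rep a \<Omega>))" using span_eq by simp
  then have "y \<in> K \<and> kf x y = 0"
  proof (induction rule: span_induct_alt)
    case base show ?case using form_zero assms zero_in by simp
  next
    case (step c v y)
    then obtain a where v: "v = rep a \<Omega>" by blast
    have "kf x v = 0" using assms(2) by (simp add: emb_def fun_eq_iff v)
    then show ?case using step assms rep_\<Omega>
      by (simp add: v form_add_right form_scale_right K_ops)
  qed
  then show "kf x y = 0" by blast
qed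

lemma inj_emb: "inj_on emb K"
proof (rule inj_onI)
  fix x y assume "x \<in> K" "y \<in> K" "emb x = emb y"
  then show "x = y" using emb_eq_0[of "x - y"] minus_in by (simp add: emb_diff)
qed

lemma pull_emb [simp]: "x \<in> K \<Longrightarrow> pull (emb x) = x"
  using inj_emb by (simp add: pull_def)

lemma pull_in: "f \<in> K' \<Longrightarrow> pull f \<in> K" by auto

lemma emb_pull: "f \<in> K' \<Longrightarrow> emb (pull f) = f" by auto

lemma pull_add: "f \<in> K' \<Longrightarrow> g \<in> K' \<Longrightarrow> pull (f + g) = pull f + pull g"
  by (auto simp: emb_add[symmetric] K_ops)

lemma pull_diff: "f \<in> K' \<Longrightarrow> g \<in> K' \<Longrightarrow> pull (f - g) = pull f - pull g"
  by (auto simp: emb_diff[symmetric] minus_in)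

lemma pull_scale: "f \<in> K' \<Longrightarrow> pull (scale_fun c f) = scale c (pull f)"
  by (auto simp: emb_scale[symmetric] K_ops)

lemma dist': "x \<in> K \<Longrightarrow> y \<in> K \<Longrightarrow> form_dist K' ip' (emb x) (emb y) = form_dist K ip x y"
  by (simp add: form_dist_def form_norm_def pull_diff)

lemma subspace': "module.subspace scale_fun (emb ` S)"
  if "S \<subseteq> K" "subspace S" for S
proof -
  interpret F: vector_space scale_fun by (rule vector_space_scale_fun)
  show ?thesis
  proof (rule F.subspaceI)
    show "0 \<in> emb ` S" using that(2) emb_0 subspace_0 by force
    show "f + g \<in> emb ` S" if "f \<in> emb ` S" "g \<in> emb ` S" for f g
      using that \<open>S \<subseteq> K\<close> \<open>subspace S\<close> emb_add subspace_add by (smt (verit) image_iff subsetD)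
    show "scale_fun c f \<in> emb ` S" if "f \<in> emb ` S" for c f
      using that \<open>S \<subseteq> K\<close> \<open>subspace S\<close> emb_scale subspace_scale by (smt (verit) image_iff subsetD)
  qed
qed

lemma hermitian_form': "hermitian_form scale_fun K' fm'"
  if "hermitian_form scale K fm" and fm': "fm' = (\<lambda>f g. fm (pull f) (pull g))" for fm fm'
proof -
  interpret h: hermitian_form scale K fm by fact
  interpret F: vector_space scale_fun by (rule vector_space_scale_fun)
  show ?thesis unfolding fm'
  proof
    show "F.subspace K'" using subspace' subspace_K by blast
  qed (auto simp: h.form_add_left h.form_scale_left emb_add[symmetric] emb_scale[symmetric] K_ops
      intro: h.form_cnj)
qed

lemma metric_space': "Metric_space K' (form_dist K' ip')"
proof
  fix f g h
  show "0 \<le> form_dist K' ip' f g"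
    using pos.Met.nonneg
    by (cases "f \<in> K' \<and> g \<in> K'") (auto simp: dist', auto simp: form_dist_def)
  show "form_dist K' ip' f g = form_dist K' ip' g f"
    using pos.Met.commute
    by (cases "f \<in> K' \<and> g \<in> K'") (auto simp: dist', auto simp: form_dist_def)
  show "form_dist K' ip' f g = 0 \<longleftrightarrow> f = g" if "f \<in> K'" "g \<in> K'"
    using that inj_emb by (auto simp: dist' inj_on_eq_iff)
  show "form_dist K' ip' f h \<le> form_dist K' ip' f g + form_dist K' ip' g h"
    if "f \<in> K'" "g \<in> K'" "h \<in> K'"
    using that pos.Met.triangle by (auto simp: dist')
qed

lemma hilbert_space': "hilbert_space scale_fun K' ip'"
proof -
  interpret M: Metric_space K' "form_dist K' ip'" by (rule metric_space')
  interpret h: hermitian_form scale_fun K' ip'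
    using hermitian_form'[OF pos.hermitian_form_axioms] by simp
  show ?thesis
  proof
    show "0 \<le> ip' f f" if "f \<in> K'" for f using that pos.ip_nonneg pull_in by blast
    show "f = 0" if "f \<in> K'" "ip' f f = 0" for f
      using that pos.ip_definite pull_in emb_pull emb_0 by metis
    show "M.mcomplete"
      unfolding M.mcomplete_def
    proof (intro allI impI)
      fix s assume s: "M.MCauchy s"
      define t where "t = (\<lambda>n. pull (s n))"
      have sK: "s n \<in> K'" for n using s by (auto simp: M.MCauchy_def)
      then have t: "t n \<in> K" "emb (t n) = s n" for n using pull_in emb_pull by (auto simp: t_def)
      have "form_dist K ip (t n) (t m) = form_dist K' ip' (s n) (s m)" for n m
        using dist'[of "t n" "t m"] t by simp
      then have "pos.Met.MCauchy t"
        using s t by (auto simp: M.MCauchy_def pos.Met.MCauchy_def)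
      then obtain x where x: "limitin pos.Met.mtopology t x sequentially"
        using pos.complete pos.Met.mcomplete_def by blast
      then have xK: "x \<in> K" using pos.Met.limit_metric_sequentially by blast
      have eq: "form_dist K' ip' (s n) (emb x) = form_dist K ip (t n) x" for n
        using dist'[of "t n" x] t xK by simp
      have "limitin M.mtopology s (emb x) sequentially"
      proof (rule M.limit_metric_sequentially[THEN iffD2], intro conjI allI impI)
        show "emb x \<in> K'" using xK by (rule imageI)
        fix e :: real assume "0 < e"
        then obtain N where N: "\<forall>n\<ge>N. form_dist K ip (t n) x < e"
          using x pos.Met.limit_metric_sequentially by blast
        have "s n \<in> K' \<and> form_dist K' ip' (s n) (emb x) < e" if "n \<ge> N" for n
        proof
          show "s n \<in> K'" by (rule sK)
          have "form_dist K ip (t n) x < e" using N that by blast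
          then show "form_dist K' ip' (s n) (emb x) < e" by (rule ord_eq_less_trans[OF eq])
        qed
        then show "\<exists>N. \<forall>n\<ge>N. s n \<in> K' \<and> form_dist K' ip' (s n) (emb x) < e" by (intro exI allI impI)
      qed
      then show "\<exists>x. limitin M.mtopology s x sequentially" by (rule exI[of _ "emb x"])
    qed
  qed
qed

lemma homeo: "homeomorphic_maps (form_topology K ip) (form_topology K' ip') emb pull"
proof -
  interpret M: hilbert_space scale_fun K' ip' by (rule hilbert_space')
  have "continuous_map pos.Met.mtopology M.Met.mtopology emb"
    unfolding pos.Met.metric_continuous_map[OF M.metric_space] by (auto simp: dist')
  moreover have "continuous_map M.Met.mtopology pos.Met.mtopology pull"
    unfolding M.Met.metric_continuous_map[OF pos.metric_space] using dist' by (auto simp: dist')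
  ultimately show ?thesis
    by (simp add: homeomorphic_maps_def pos.form_topology_eq M.form_topology_eq)
qed

lemma krein_space': "krein_space scale_fun K' kf' ip' J'"
proof -
  interpret h: hermitian_form scale_fun K' kf'
    using hermitian_form'[OF hermitian_form_axioms] by simp
  interpret M: hilbert_space scale_fun K' ip' by (rule hilbert_space')
  show ?thesis
    by unfold_locales
      (auto simp: pull_add pull_scale J_add J_scale emb_add emb_scale J_closed J_selfadjoint
        J_involution kf_eq)
qed

lemma topspace_K: "topspace (form_topology K ip) = K"
  by (simp add: pos.form_topology_eq)

lemma dense': "form_topology K' ip' closure_of D' = K'"
  using homeomorphic_map_closure_of[of "form_topology K ip" "form_topology K' ip'" emb D]
    homeo D_subset D_dense topspace_K homeomorphic_map_maps by metis

lemma closable': "closable_operator K' ip' D' (rep' a)"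
proof -
  let ?X = "form_topology K ip" and ?Y = "form_topology K' ip'"
  let ?e = "\<lambda>(x, y). (emb x, emb y)"
  let ?G = "{(x, rep a x) |x. x \<in> D}"
  have "homeomorphic_maps (prod_topology ?X ?X) (prod_topology ?Y ?Y) ?e (\<lambda>(x, y). (pull x, pull y))"
    using homeo by (simp add: homeomorphic_maps_prod)
  then have "homeomorphic_map (prod_topology ?X ?X) (prod_topology ?Y ?Y) ?e"
    using homeomorphic_map_maps by blast
  then have "prod_topology ?Y ?Y closure_of (?e ` ?G) = ?e ` (prod_topology ?X ?X closure_of ?G)"
    by (rule homeomorphic_map_closure_of) (use DK rep_closed topspace_K in auto)
  moreover have "?e ` ?G = {(f, rep' a f) |f. f \<in> D'}"
  proof -
    have "rep' a (emb x) = emb (rep a x)" if "x \<in> D" for x using that DK by simp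
    then show ?thesis by force
  qed
  moreover have "prod_topology ?X ?X closure_of ?G \<subseteq> K \<times> K"
    using closure_of_subset_topspace[of "prod_topology ?X ?X" ?G] topspace_K by simp
  moreover have "single_valued (prod_topology ?X ?X closure_of ?G)"
    using rep_closable by (simp add: closable_operator_def)
  moreover have "single_valued (?e ` R)" if "R \<subseteq> K \<times> K" "single_valued R" for R
  proof (rule single_valuedI)
    fix f g h assume "(f, g) \<in> ?e ` R" "(f, h) \<in> ?e ` R"
    then obtain x y x' z where *: "(x, y) \<in> R" "(x', z) \<in> R" "f = emb x" "f = emb x'" "g = emb y" "h = emb z"
      by auto
    then have "x = x'" using that inj_emb by (metis inj_onD mem_Sigma_iff subsetD)
    then show "g = h" using * that(2) single_valuedD by metis
  qed
  ultimately show ?thesis by (simp add: closable_operator_def)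
qed

lemma krein_adjoint_rel_rep: 
  assumes "x \<in> D" shows "krein_adjoint_rel K kf D (rep a) x z \<longleftrightarrow> z = rep (star a) x"
proof -
  have uniq: "z = z'" if "krein_adjoint_rel K kf D (rep a) x z" "krein_adjoint_rel K kf D (rep a) x z'"
    for z z'
  proof -
    have K: "z \<in> K" "z' \<in> K" using that by (auto simp: krein_adjoint_rel_def)
    have "kf (z - z') y = 0" if "y \<in> D" for y
    proof -
      have "kf y z = kf y z'"
        using that \<open>krein_adjoint_rel K kf D (rep a) x z\<close> \<open>krein_adjoint_rel K kf D (rep a) x z'\<close>
        by (simp add: krein_adjoint_rel_def)
      then have "kf y (z - z') = 0" using K that DK by (simp add: form_diff_right)
      then show ?thesis using form_cnj[of "z - z'" y] K that DK minus_in by simp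
    qed
    then show ?thesis using separated_by_D[of "z - z'"] K minus_in by simp
  qed
  obtain z0 where z0: "krein_adjoint_rel K kf D (rep a) x z0"
    using adjoint_dom_rep assms by (force simp: krein_adjoint_dom_def)
  have "krein_adjoint K kf D (rep a) x = z0"
    unfolding krein_adjoint_def using z0 uniq by blast
  then show ?thesis using adjoint_rep assms z0 uniq by metis
qed

lemma krein_adjoint_rel_rep':
  assumes "f \<in> D'"
  shows "krein_adjoint_rel K' kf' D' (rep' a) f g \<longleftrightarrow> g = rep' (star a) f"
proof -
  obtain x where x: "x \<in> D" "f = emb x" using assms by blast
  have "krein_adjoint_rel K' kf' D' (rep' a) f g \<longleftrightarrow>
      g \<in> K' \<and> krein_adjoint_rel K kf D (rep a) x (pull g)"
    using x DK rep_closed by (auto simp: krein_adjoint_rel_def)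
  also have "\<dots> \<longleftrightarrow> g \<in> K' \<and> pull g = rep (star a) x" using krein_adjoint_rel_rep x by simp
  also have "\<dots> \<longleftrightarrow> g = rep' (star a) f"
    using x DK rep_closed by (auto simp: DK rep_closed)
  finally show ?thesis .
qed

lemma transport: "bounded_gns_data scaleA star scale_fun K' kf' ip' J' D' rep' Z (emb \<Omega>)"
proof -
  interpret k: krein_space scale_fun K' kf' ip' J' by (rule krein_space')
  have rD: "rep a x \<in> K" if "x \<in> D" for a x using that DK rep_closed by blast
  interpret c: closable_representation scaleA star scale_fun K' kf' ip' J' D' rep'
    by unfold_locales
      (use subspace'[OF D_subset subspace_D] dense' closable' in
        \<open>auto simp: DK rD rep_closed pull_add pull_scale rep_op_add rep_op_scale rep_add rep_scale
          rep_mult emb_add emb_scale\<close>)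
  have "hermitian_representation scaleA star scale_fun K' kf' ip' J' D' rep'"
  proof
    show "D' \<subseteq> krein_adjoint_dom K' kf' D' (rep' a)" for a
      using krein_adjoint_rel_rep' by (auto simp: krein_adjoint_dom_def)
    show "krein_adjoint K' kf' D' (rep' a) f = rep' (star a) f" if "f \<in> D'" for f a
      unfolding krein_adjoint_def
      by (rule the_equality) (use krein_adjoint_rel_rep'[OF that] in blast)+
  qed
  then interpret r: hermitian_representation scaleA star scale_fun K' kf' ip' J' D' rep' .
  have "k.span (range (\<lambda>a. rep' a (emb \<Omega>))) = D'"
  proof
    have R: "rep' a (emb \<Omega>) = emb (rep a \<Omega>)" for a using DK \<Omega>_in_D by simp
    show "k.span (range (\<lambda>a. rep' a (emb \<Omega>))) \<subseteq> D'"
      by (rule k.span_minimal) (use R rep_\<Omega> c.subspace_D in auto)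
    have "y \<in> K \<and> emb y \<in> k.span (range (\<lambda>a. rep' a (emb \<Omega>)))" if "y \<in> D" for y
      using that unfolding span_eq[symmetric]
    proof (induction rule: span_induct_alt)
      case base show ?case using zero_in k.span_zero unfolding emb_0 by blast
    next
      case (step c v y)
      then obtain a where v: "v = rep a \<Omega>" by blast
      have vK: "v \<in> K" and yK: "y \<in> K" using v rep_\<Omega> step by auto
      have "emb v \<in> k.span (range (\<lambda>a. rep' a (emb \<Omega>)))"
        unfolding v by (rule k.span_base, subst R[symmetric], rule rangeI)
      then have "scale_fun c (emb v) + emb y \<in> k.span (range (\<lambda>a. rep' a (emb \<Omega>)))"
        using step by (intro k.span_add k.span_scale) (simp_all only: simp_thms)
      then show ?case
        using K_ops(1)[OF K_ops(2)[OF vK] yK]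
        by (simp only: emb_add[OF K_ops(2)[OF vK] yK] emb_scale[OF vK] simp_thms)
    qed
    then show "D' \<subseteq> k.span (range (\<lambda>a. rep' a (emb \<Omega>)))" by blast
  qed
  moreover have "bounded_operator ip' D' (rep' a)" for a
    using rep_bounded[of a] rD DK by (auto simp: bounded_operator_def form_norm_def)
  ultimately show ?thesis
    by (intro bounded_gns_data.intro gns_data.intro gns_data_axioms.intro
        bounded_gns_data_axioms.intro r.hermitian_representation_axioms imageI \<Omega>_in_D)
      (simp_all add: \<Omega>_in_D DK rep_\<Omega> Z_eq)
qed

end

lemma admits_bounded_gns_dataI:
  "bounded_gns_data scaleA star sc K kf ip J D rep Z \<Omega> \<Longrightarrow> admits_bounded_gns_data scaleA star Z"
  unfolding admits_bounded_gns_data_def by (intro exI) (rule bounded_gns_data.transport)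

end

(*
  On the free vector space V over the algebra the functional and the kernel induce a hermitian form b
  and a positive form with |b(u,u)| <= L(u,u), and a acts on V by x |-> a x.  A Krein space completion
  of (V,b) amounts to a positive form q whose Gram operator G for b satisfies G^2 = 1.  Instead of
  computing |G| spectrally, take q minimal (Zorn) among the positive forms dominating |b| for which
  the action of each a is bounded with a constant symmetric in a and its adjoint.  The form of (1 + G^2)/2 is
  again of this kind and lies below q, so minimality forces G^2 = 1; the symmetry G, the boundedness
  and the nondegeneracy of b all come with q.

  Conversely the kernel L(x,y) = <pi(star y) Omega, pi(star x) Omega> works, since J is an isometry.
*)
theory Submission
  imports Defs "HOL-Library.Poly_Mapping"
begin

section \<open>Completion of a positive semidefinite form\<close>

text \<open>\<open>L\<close> is not assumed to be sesquilinear, so it yields a form only on formal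
  combinations of algebra elements; this is why the free vector space carries the construction. The
  price is that the operators \<open>T a\<close> depend linearly on \<open>a\<close> only after
  pairing with \<open>b\<close>. The identity G^2 = 1 repairs this: vectors that \<open>b\<close>
  cannot see are then null for the majorant, so the linear relations of the algebra hold in the
  completion.

  The symmetry of the constants comes from duality: \<open>b (T a u) v = b u (T (star a) v)\<close>
  turns a bound for \<open>T (star a)\<close> into a bound for \<open>T a\<close> on the vectors G
  u, and with equal constants the class of admissible forms is closed under passing to (1 + G^2)/2.
  This polynomial is chosen because |g| <= (1 + g^2)/2 <= 1 on [-1,1], with equality on the right
  only if g^2 = 1: the new form is still a majorant, never larger, and different from the old one
  unless G is a symmetry.\<close>

locale semi_inner = hermitian_form scale UNIV q
  for scale :: "complex \<Rightarrow> 'v::ab_group_add \<Rightarrow> 'v" and q +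
  assumes nonneg: "0 \<le> q x x"
begin

lemma add_left: "q (x + y) z = q x z + q y z"
  and add_right: "q z (x + y) = q z x + q z y"
  and diff_left: "q (x - y) z = q x z - q y z"
  and diff_right: "q z (x - y) = q z x - q z y"
  and scale_left: "q (scale c x) z = c * q x z"
  and scale_right: "q z (scale c x) = cnj c * q z x"
  and zero: "q 0 x = 0" "q x 0 = 0"
  by (simp_all add: form_add_left form_add_right form_diff_left form_diff_right
      form_scale_left form_scale_right form_zero)

lemma cnj_form: "cnj (q x y) = q y x"
  using form_cnj[of y x] by simp

lemma self_eq: "q x x = complex_of_real ((form_norm q x)\<^sup>2)"
  using nonneg[of x] by (auto simp: form_norm_def complex_eq_iff less_eq_complex_def)

lemma norm_nonneg [simp]: "0 \<le> form_norm q x"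
  using nonneg[of x] by (auto simp: form_norm_def less_eq_complex_def)

lemma norm_sq: "(form_norm q x)\<^sup>2 = Re (q x x)"
  by (simp add: self_eq)

text \<open>Since \<open>q y y\<close> may vanish, the usual coefficient is taken with denominator
  \<open>q y y + e\<close>; the inequality for \<open>e > 0\<close> then passes to the limit
  \<open>e = 0\<close>.\<close>

lemma cauchy_schwarz: "cmod (q x y) \<le> form_norm q x * form_norm q y"
proof -
  have *: "(cmod (q x y))\<^sup>2 \<le> (form_norm q x)\<^sup>2 * ((form_norm q y)\<^sup>2 + e)" if "0 < e" for e
  proof -
    define N where "N = (form_norm q y)\<^sup>2"
    have N: "0 \<le> N" by (simp add: N_def)
    have Ne: "0 < N + e" using N that by simp
    define c where "c = q x y / complex_of_real (N + e)"
    have "0 \<le> q (x - scale c y) (x - scale c y)" by (rule nonneg)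
    also have "\<dots> = q x x - cnj c * q x y - c * cnj (q x y) + c * cnj c * q y y"
      using form_cnj[of y x]
      by (simp add: diff_left diff_right scale_left scale_right algebra_simps)
    also have "\<dots> = complex_of_real ((form_norm q x)\<^sup>2 - 2 * (cmod (q x y))\<^sup>2 / (N + e)
        + (cmod (q x y))\<^sup>2 * N / (N + e)\<^sup>2)"
    proof -
      have pp: "q x y * cnj (q x y) = complex_of_real ((cmod (q x y))\<^sup>2)"
        by (metis complex_norm_square)
      have "cnj c * q x y = complex_of_real ((cmod (q x y))\<^sup>2 / (N + e))"
        "c * cnj (q x y) = complex_of_real ((cmod (q x y))\<^sup>2 / (N + e))"
        "c * cnj c = complex_of_real ((cmod (q x y))\<^sup>2 / (N + e)\<^sup>2)"
        unfolding of_real_divide pp[symmetric] by (simp_all add: c_def power2_eq_square)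
      then show ?thesis unfolding self_eq[of y] N_def[symmetric] by (simp add: self_eq[of x])
    qed
    finally have "0 \<le> (form_norm q x)\<^sup>2 - 2 * (cmod (q x y))\<^sup>2 / (N + e)
        + (cmod (q x y))\<^sup>2 * N / (N + e)\<^sup>2" by (simp add: less_eq_complex_def)
    moreover have "(cmod (q x y))\<^sup>2 * N / (N + e)\<^sup>2 \<le> (cmod (q x y))\<^sup>2 / (N + e)"
    proof -
      have "N / (N + e)\<^sup>2 \<le> 1 / (N + e)"
        using Ne that divide_right_mono[of "N / (N + e)" 1 "N + e"] by (simp add: power2_eq_square)
      then have "(cmod (q x y))\<^sup>2 * (N / (N + e)\<^sup>2) \<le> (cmod (q x y))\<^sup>2 * (1 / (N + e))"
        by (rule mult_left_mono) simp
      then show ?thesis by simp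
    qed
    ultimately have "(cmod (q x y))\<^sup>2 / (N + e) \<le> (form_norm q x)\<^sup>2" by simp
    then show ?thesis using Ne by (simp add: N_def field_simps)
  qed
  have "(cmod (q x y))\<^sup>2 \<le> (form_norm q x)\<^sup>2 * (form_norm q y)\<^sup>2"
  proof (rule tendsto_lowerbound)
    show "((\<lambda>e. (form_norm q x)\<^sup>2 * ((form_norm q y)\<^sup>2 + e)) \<longlongrightarrow> (form_norm q x)\<^sup>2 * (form_norm q y)\<^sup>2)
        (at_right 0)"
      by (auto intro!: tendsto_eq_intros)
    show "\<forall>\<^sub>F e in at_right 0. (cmod (q x y))\<^sup>2 \<le> (form_norm q x)\<^sup>2 * ((form_norm q y)\<^sup>2 + e)"
      using * by (auto simp: eventually_at_right_less intro: eventually_at_rightI[of 0 1])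
  qed simp
  then have "(cmod (q x y))\<^sup>2 \<le> (form_norm q x * form_norm q y)\<^sup>2"
    by (simp add: power_mult_distrib)
  then show ?thesis by (rule power2_le_imp_le) simp
qed

lemma norm_scale: "form_norm q (scale c x) = cmod c * form_norm q x"
proof -
  have "q (scale c x) (scale c x) = complex_of_real ((cmod c)\<^sup>2) * q x x"
    unfolding scale_left scale_right mult.assoc[symmetric] complex_norm_square by (simp add: mult.commute)
  then have "Re (q (scale c x) (scale c x)) = (cmod c)\<^sup>2 * Re (q x x)"
    by (simp only: times_complex.simps Re_complex_of_real Im_complex_of_real mult_zero_left diff_zero)
  then show ?thesis by (simp add: form_norm_def real_sqrt_mult)
qed

lemma norm_triangle: "form_norm q (x + y) \<le> form_norm q x + form_norm q y"
proof (rule power2_le_imp_le)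
  have "(form_norm q (x + y))\<^sup>2 = (form_norm q x)\<^sup>2 + (form_norm q y)\<^sup>2 + 2 * Re (q x y)"
    using form_cnj[of y x] by (simp add: norm_sq add_left add_right)
  also have "\<dots> \<le> (form_norm q x + form_norm q y)\<^sup>2"
    using cauchy_schwarz[of x y] complex_Re_le_cmod[of "q x y"] by (simp add: power2_sum)
  finally show "(form_norm q (x + y))\<^sup>2 \<le> (form_norm q x + form_norm q y)\<^sup>2" .
qed simp

lemma norm_minus_commute: "form_norm q (x - y) = form_norm q (y - x)"
  by (simp add: form_norm_def diff_left diff_right algebra_simps)

text \<open>
  A Cauchy sequence is identified with the antilinear functional it represents, which makes the
  quotient by null sequences unnecessary; \<open>x\<close> is embedded as \<open>q x\<close>.
\<close>

definition cauchy :: "(nat \<Rightarrow> 'v) \<Rightarrow> bool" where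
  "cauchy u \<longleftrightarrow> (\<forall>e>0. \<exists>N. \<forall>m\<ge>N. \<forall>n\<ge>N. form_norm q (u m - u n) < e)"

definition represents :: "(nat \<Rightarrow> 'v) \<Rightarrow> ('v \<Rightarrow> complex) \<Rightarrow> bool" where
  "represents u f \<longleftrightarrow> cauchy u \<and> (\<forall>v. (\<lambda>n. q (u n) v) \<longlonglongrightarrow> f v)"

definition completion :: "('v \<Rightarrow> complex) set" where
  "completion = {f. \<exists>u. represents u f}"

text \<open>\<open>SOME\<close> picks one representing sequence for each functional; by
  \<open>cip_eqI\<close> any other choice gives the same limit.\<close>

definition cip :: "('v \<Rightarrow> complex) \<Rightarrow> ('v \<Rightarrow> complex) \<Rightarrow> complex" where
  "cip f g = lim (\<lambda>n. q ((SOME u. represents u f) n) ((SOME u. represents u g) n))"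

lemma cauchyD: "cauchy u \<Longrightarrow> 0 < e \<Longrightarrow> \<exists>N. \<forall>m\<ge>N. \<forall>n\<ge>N. form_norm q (u m - u n) < e"
  by (simp add: cauchy_def)

lemma cauchy_bounded:
  assumes "cauchy u" obtains B where "0 < B" "\<And>n. form_norm q (u n) \<le> B"
proof -
  obtain N where N: "\<And>n. n \<ge> N \<Longrightarrow> form_norm q (u n - u N) < 1"
    using cauchyD[OF assms, of 1] by auto
  define B where "B = (\<Sum>k\<le>N. form_norm q (u k)) + 1"
  have B: "form_norm q (u k) \<le> B - 1" if "k \<le> N" for k
    unfolding B_def using member_le_sum[of k "{..N}" "\<lambda>k. form_norm q (u k)"] that by simp
  show ?thesis
  proof
    show "0 < B" using order_trans[OF norm_nonneg B[of 0]] by simp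
    fix n show "form_norm q (u n) \<le> B"
    proof (cases "n \<le> N")
      case True then show ?thesis using B[of n] by simp
    next
      case False
      then show ?thesis using N[of n] B[of N] norm_triangle[of "u n - u N" "u N"] by simp
    qed
  qed
qed

lemma cauchy_linear:
  assumes "cauchy u" "cauchy v"
  shows "cauchy (\<lambda>n. u n + v n)" "cauchy (\<lambda>n. u n - v n)"
proof -
  have 1: "\<exists>N. \<forall>m\<ge>N. \<forall>n\<ge>N. form_norm q (u m - u n) + form_norm q (v m - v n) < e" if "0 < e" for e
  proof -
    obtain N M where "\<forall>m\<ge>N. \<forall>n\<ge>N. form_norm q (u m - u n) < e/2"
      "\<forall>m\<ge>M. \<forall>n\<ge>M. form_norm q (v m - v n) < e/2"
      using cauchyD[OF assms(1), of "e/2"] cauchyD[OF assms(2), of "e/2"] \<open>0 < e\<close> by auto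
    then show ?thesis by (intro exI[of _ "max N M"]) (fastforce intro: field_sum_of_halves)
  qed
  have "form_norm q ((u m + v m) - (u n + v n)) \<le> form_norm q (u m - u n) + form_norm q (v m - v n)"
    for m n using norm_triangle[of "u m - u n" "v m - v n"] by (simp add: algebra_simps)
  then show "cauchy (\<lambda>n. u n + v n)" using 1 unfolding cauchy_def by (meson le_less_trans)
  have "form_norm q ((u m - v m) - (u n - v n)) \<le> form_norm q (u m - u n) + form_norm q (v m - v n)"
    for m n using norm_triangle[of "u m - u n" "v n - v m"] norm_minus_commute[of "v m" "v n"]
    by (simp add: algebra_simps)
  then show "cauchy (\<lambda>n. u n - v n)" using 1 unfolding cauchy_def by (meson le_less_trans)
qed

lemma cauchy_const: "cauchy (\<lambda>_. x)"
  by (simp add: cauchy_def form_norm_def zero)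

lemma cauchy_scale: assumes "cauchy u" shows "cauchy (\<lambda>n. scale c (u n))"
  unfolding cauchy_def
proof (intro allI impI)
  fix e :: real assume "0 < e"
  then have "0 < e / (cmod c + 1)" by (simp add: add_nonneg_pos)
  then obtain N where N: "\<And>m n. m \<ge> N \<Longrightarrow> n \<ge> N \<Longrightarrow> form_norm q (u m - u n) < e / (cmod c + 1)"
    using cauchyD[OF assms] by blast
  have "form_norm q (scale c (u m) - scale c (u n)) < e" if "m \<ge> N" "n \<ge> N" for m n
  proof -
    have "form_norm q (scale c (u m) - scale c (u n)) \<le> (cmod c + 1) * form_norm q (u m - u n)"
      by (simp add: scale_right_diff_distrib[symmetric] norm_scale mult_right_mono)
    also have "\<dots> < (cmod c + 1) * (e / (cmod c + 1))"
      using N[OF that] by (intro mult_strict_left_mono) (auto simp: add_nonneg_pos)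
    also have "\<dots> = e" using add_nonneg_pos[OF norm_ge_zero[of c] zero_less_one] by simp
    finally show ?thesis .
  qed
  then show "\<exists>N. \<forall>m\<ge>N. \<forall>n\<ge>N. form_norm q (scale c (u m) - scale c (u n)) < e" by blast
qed

lemma cauchy_convergent_form:
  assumes "cauchy u" "cauchy v" shows "convergent (\<lambda>n. q (u n) (v n))"
proof -
  obtain A where A: "0 < A" "\<And>n. form_norm q (u n) \<le> A" using cauchy_bounded[OF assms(1)] by blast
  obtain B where B: "0 < B" "\<And>n. form_norm q (v n) \<le> B" using cauchy_bounded[OF assms(2)] by blast
  have "Cauchy (\<lambda>n. q (u n) (v n))"
  proof (rule CauchyI)
    fix e :: real assume e: "0 < e"
    obtain N M where N: "\<forall>m\<ge>N. \<forall>n\<ge>N. form_norm q (u m - u n) < e / (2 * B)"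
      and M: "\<forall>m\<ge>M. \<forall>n\<ge>M. form_norm q (v m - v n) < e / (2 * A)"
      using cauchyD[OF assms(1), of "e/(2*B)"] cauchyD[OF assms(2), of "e/(2*A)"] e A(1) B(1) by auto
    have "norm (q (u m) (v m) - q (u n) (v n)) < e" if "m \<ge> max N M" "n \<ge> max N M" for m n
    proof -
      have "q (u m) (v m) - q (u n) (v n) = q (u m - u n) (v m) + q (u n) (v m - v n)"
        by (simp add: diff_left diff_right)
      also have "norm \<dots> \<le> form_norm q (u m - u n) * form_norm q (v m)
          + form_norm q (u n) * form_norm q (v m - v n)"
        using norm_triangle_ineq cauchy_schwarz add_mono order_trans by meson
      also have "\<dots> \<le> form_norm q (u m - u n) * B + A * form_norm q (v m - v n)"
        using A B by (intro add_mono mult_mono) auto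
      also have "\<dots> < e / (2 * B) * B + A * (e / (2 * A))"
        using A B N M that by (intro add_strict_mono mult_strict_right_mono mult_strict_left_mono) auto
      also have "\<dots> = e" using A B by simp
      finally show ?thesis .
    qed
    then show "\<exists>M. \<forall>m\<ge>M. \<forall>n\<ge>M. norm (q (u m) (v m) - q (u n) (v n)) < e" by blast
  qed
  then show ?thesis by (rule Cauchy_convergent)
qed

lemma cauchy_represents:
  assumes "cauchy u" obtains f where "represents u f"
proof
  show "represents u (\<lambda>v. lim (\<lambda>n. q (u n) v))"
    using assms cauchy_convergent_form[OF assms cauchy_const]
    by (simp add: represents_def convergent_LIMSEQ_iff)
qed

lemma represents_linear:
  assumes "represents u f" "represents v g"
  shows "represents (\<lambda>n. u n + v n) (f + g)" "represents (\<lambda>n. u n - v n) (f - g)"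
  using assms unfolding represents_def
  by (auto simp: add_left diff_left intro!: cauchy_linear tendsto_add tendsto_diff)

lemma represents_scale:
  assumes "represents u f" shows "represents (\<lambda>n. scale c (u n)) (scale_fun c f)"
  using assms unfolding represents_def
  by (auto simp: scale_left scale_fun_def intro!: cauchy_scale tendsto_mult_left)

lemma represents_const: "represents (\<lambda>_. x) (q x)"
  by (simp add: represents_def cauchy_const)

text \<open>Split \<open>q (u n) (u n)\<close> as
  \<open>q (u n) (u n - u N) + q (u n) (u N)\<close>: the first term is small because the sequence
  is Cauchy and bounded, the second because \<open>N\<close> is fixed. Consequently a functional
  determines its representing sequence up to null sequences, which makes \<open>cip\<close> well
  defined.\<close>

lemma represents_zero:
  assumes "represents u 0" shows "(\<lambda>n. form_norm q (u n)) \<longlonglongrightarrow> 0"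
proof (rule LIMSEQ_I)
  fix e :: real assume e: "0 < e"
  have u: "cauchy u" and w: "(\<lambda>n. q (u n) v) \<longlonglongrightarrow> 0" for v
    using assms by (auto simp: represents_def)
  obtain B where B: "0 < B" "\<And>n. form_norm q (u n) \<le> B" using cauchy_bounded[OF u] by blast
  have "0 < e\<^sup>2 / (2 * B)" using e B by simp
  then obtain N where N: "\<And>n. n \<ge> N \<Longrightarrow> form_norm q (u n - u N) < e\<^sup>2 / (2 * B)"
    using cauchyD[OF u] by blast
  obtain M where M: "\<And>n. n \<ge> M \<Longrightarrow> cmod (q (u n) (u N)) < e\<^sup>2 / 2"
    using LIMSEQ_D[OF w[of "u N"], of "e\<^sup>2/2"] e by auto
  have "form_norm q (u n) < e" if n: "n \<ge> max N M" for n
  proof (rule power_less_imp_less_base)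
    have "(form_norm q (u n))\<^sup>2 = cmod (q (u n) (u n - u N) + q (u n) (u N))"
      by (simp add: diff_right self_eq norm_power del: of_real_power)
    also have "\<dots> \<le> form_norm q (u n) * form_norm q (u n - u N) + cmod (q (u n) (u N))"
      using norm_triangle_ineq cauchy_schwarz add_mono order_trans order_refl by meson
    also have "\<dots> < B * (e\<^sup>2 / (2 * B)) + e\<^sup>2 / 2"
    proof (rule add_le_less_mono)
      show "form_norm q (u n) * form_norm q (u n - u N) \<le> B * (e\<^sup>2 / (2 * B))"
        using B N[of n] n by (intro mult_mono) auto
    qed (use M n in auto)
    also have "\<dots> = e\<^sup>2" using B by simp
    finally show "(form_norm q (u n))\<^sup>2 < e\<^sup>2" .
  qed (use e in simp)
  then show "\<exists>no. \<forall>n\<ge>no. norm (form_norm q (u n) - 0) < e"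
    by (intro exI[of _ "max N M"]) simp
qed

lemma cip_eqI:
  assumes "represents u f" "represents v g"
  shows "(\<lambda>n. q (u n) (v n)) \<longlonglongrightarrow> cip f g"
proof -
  define u' v' where "u' = (SOME u. represents u f)" and "v' = (SOME v. represents v g)"
  have u': "represents u' f" and v': "represents v' g"
    unfolding u'_def v'_def by (rule someI[of "\<lambda>u. represents u _"], rule assms)+
  have du: "(\<lambda>n. form_norm q (u n - u' n)) \<longlonglongrightarrow> 0" and dv: "(\<lambda>n. form_norm q (v n - v' n)) \<longlonglongrightarrow> 0"
    using represents_zero represents_linear(2)[OF assms(1) u'] represents_linear(2)[OF assms(2) v'] by auto
  have c: "cauchy u" "cauchy v'" using assms u' v' by (auto simp: represents_def)
  obtain A where A: "0 < A" "\<And>n. form_norm q (u n) \<le> A" using cauchy_bounded[OF c(1)] by blast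
  obtain B where B: "0 < B" "\<And>n. form_norm q (v' n) \<le> B" using cauchy_bounded[OF c(2)] by blast
  have l: "(\<lambda>n. q (u' n) (v' n)) \<longlonglongrightarrow> cip f g"
    unfolding cip_def u'_def[symmetric] v'_def[symmetric]
    using cauchy_convergent_form u' v' by (simp add: represents_def convergent_LIMSEQ_iff)
  have "(\<lambda>n. q (u n) (v n) - q (u' n) (v' n)) \<longlonglongrightarrow> 0"
  proof (rule Lim_null_comparison)
    show "\<forall>\<^sub>F n in sequentially. norm (q (u n) (v n) - q (u' n) (v' n))
        \<le> form_norm q (u n - u' n) * B + A * form_norm q (v n - v' n)"
    proof (intro always_eventually allI)
      fix n
      have "q (u n) (v n) - q (u' n) (v' n) = q (u n - u' n) (v' n) + q (u n) (v n - v' n)"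
        by (simp add: diff_left diff_right)
      also have "norm \<dots> \<le> form_norm q (u n - u' n) * form_norm q (v' n)
          + form_norm q (u n) * form_norm q (v n - v' n)"
        using norm_triangle_ineq cauchy_schwarz add_mono order_trans by meson
      also have "\<dots> \<le> form_norm q (u n - u' n) * B + A * form_norm q (v n - v' n)"
        using A B by (intro add_mono mult_mono) auto
      finally show "norm (q (u n) (v n) - q (u' n) (v' n))
        \<le> form_norm q (u n - u' n) * B + A * form_norm q (v n - v' n)" .
    qed
    show "(\<lambda>n. form_norm q (u n - u' n) * B + A * form_norm q (v n - v' n)) \<longlonglongrightarrow> 0"
      using tendsto_add[OF tendsto_mult_right[OF du] tendsto_mult_left[OF dv], of B A] by simp
  qed
  from tendsto_add[OF this l] show ?thesis by simp
qed

lemma cip_const: "cip (q x) (q y) = q x y"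
  using cip_eqI[OF represents_const represents_const, of x y] by (simp add: LIMSEQ_const_iff)

text \<open>Reproducing property: both sides are the limit of \<open>q (u n) y\<close>, so
  evaluation at \<open>y\<close> is pairing with the embedded vector \<open>q y\<close>.\<close>

lemma cip_const_right: assumes "f \<in> completion" shows "cip f (q y) = f y"
proof -
  obtain u where u: "represents u f" using assms by (auto simp: completion_def)
  have "(\<lambda>n. q (u n) y) \<longlonglongrightarrow> cip f (q y)" by (rule cip_eqI[OF u represents_const])
  moreover have "(\<lambda>n. q (u n) y) \<longlonglongrightarrow> f y" using u by (simp add: represents_def)
  ultimately show ?thesis by (rule LIMSEQ_unique)
qed

lemma const_in: "q x \<in> completion"
  using represents_const by (auto simp: completion_def)

lemma hermitian_form_completion: "hermitian_form scale_fun completion cip"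
proof -
  interpret F: vector_space scale_fun by (rule vector_space_scale_fun)
  show ?thesis
  proof
    show "F.subspace completion"
    proof (rule F.subspaceI)
      have "q 0 = 0" by (rule ext) (simp add: zero)
      then show "0 \<in> completion" using const_in[of 0] by simp
    qed (auto simp: completion_def intro: represents_linear represents_scale)
  next
    fix f g h assume "f \<in> completion" "g \<in> completion" "h \<in> completion"
    then obtain u v w where *: "represents u f" "represents v g" "represents w h"
      by (auto simp: completion_def)
    show "cip (f + g) h = cip f h + cip g h"
      using LIMSEQ_unique[OF cip_eqI[OF represents_linear(1)[OF *(1,2)] *(3)]]
        tendsto_add[OF cip_eqI[OF *(1,3)] cip_eqI[OF *(2,3)]] by (simp add: add_left)
  next
    fix f g h c assume "f \<in> completion" "h \<in> completion"
    then obtain u w where *: "represents u f" "represents w h"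
      by (auto simp: completion_def)
    show "cip (scale_fun c f) h = c * cip f h"
      using LIMSEQ_unique[OF cip_eqI[OF represents_scale[OF *(1)] *(2)]]
        tendsto_mult_left[OF cip_eqI[OF *]] by (simp add: scale_left)
    have "(\<lambda>n. q (u n) (w n)) \<longlonglongrightarrow> cnj (cip h f)"
      using tendsto_cnj[OF cip_eqI[OF *(2,1)]] by (simp add: cnj_form)
    then show "cip f h = cnj (cip h f)" using cip_eqI[OF *] LIMSEQ_unique by blast
  qed
qed

lemma cip_nonneg:
  assumes "f \<in> completion" shows "0 \<le> cip f f"
proof -
  obtain u where u: "represents u f" using assms by (auto simp: completion_def)
  have "(\<lambda>n. q (u n) (u n)) \<longlonglongrightarrow> cip f f" by (rule cip_eqI[OF u u])
  then have 1: "(\<lambda>n. Re (q (u n) (u n))) \<longlonglongrightarrow> Re (cip f f)" "(\<lambda>n. Im (q (u n) (u n))) \<longlonglongrightarrow> Im (cip f f)"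
    by (auto intro: tendsto_intros)
  have "0 \<le> Re (cip f f)"
    by (rule LIMSEQ_le_const[OF 1(1)]) (use nonneg in \<open>auto simp: less_eq_complex_def\<close>)
  moreover have "Im (cip f f) = 0"
    using 1(2) by (simp add: self_eq LIMSEQ_const_iff)
  ultimately show ?thesis by (simp add: less_eq_complex_def)
qed

lemma represents_norm:
  assumes "represents u f" shows "(\<lambda>n. form_norm q (u n)) \<longlonglongrightarrow> form_norm cip f"
  unfolding form_norm_def by (intro tendsto_intros cip_eqI assms)

text \<open>For fixed \<open>n\<close> the difference \<open>f - q (u n)\<close> is represented by
  the sequence \<open>u m - u n\<close> in \<open>m\<close>, whose norms the Cauchy property
  controls. This is the density of the embedded vectors.\<close>

lemma represents_approx:
  assumes "represents u f" shows "(\<lambda>n. form_norm cip (f - q (u n))) \<longlonglongrightarrow> 0"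
proof (rule LIMSEQ_I)
  fix e :: real assume e: "0 < e"
  have "cauchy u" using assms by (simp add: represents_def)
  from cauchyD[OF this, of "e/2"] e obtain N where
    N: "\<And>m n. m \<ge> N \<Longrightarrow> n \<ge> N \<Longrightarrow> form_norm q (u m - u n) < e/2" by auto
  have "form_norm cip (f - q (u n)) \<le> e/2" if n: "n \<ge> N" for n
  proof (rule LIMSEQ_le_const2)
    show "(\<lambda>m. form_norm q (u m - u n)) \<longlonglongrightarrow> form_norm cip (f - q (u n))"
      by (rule represents_norm[OF represents_linear(2)[OF assms represents_const]])
    show "\<exists>N. \<forall>m\<ge>N. form_norm q (u m - u n) \<le> e/2" using N[OF _ n] by (meson less_imp_le)
  qed
  moreover have "0 \<le> form_norm cip (f - q (u n))" for n
    using LIMSEQ_le_const[OF represents_norm[OF represents_linear(2)[OF assms represents_const]]]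
      norm_nonneg by blast
  moreover have "e / 2 < e" using e by simp
  ultimately have "norm (form_norm cip (f - q (u n)) - 0) < e" if "n \<ge> N" for n
    using that by (metis abs_of_nonneg diff_zero le_less_trans real_norm_def)
  then show "\<exists>no. \<forall>n\<ge>no. norm (form_norm cip (f - q (u n)) - 0) < e" by blast
qed

lemma cip_definite:
  assumes "f \<in> completion" "cip f f = 0" shows "f = 0"
proof
  fix v
  obtain u where u: "represents u f" using assms by (auto simp: completion_def)
  have n: "(\<lambda>n. form_norm q (u n) * form_norm q v) \<longlonglongrightarrow> 0"
    using tendsto_mult_right[OF represents_norm[OF u]] assms(2) by (simp add: form_norm_def)
  have "(\<lambda>n. q (u n) v) \<longlonglongrightarrow> 0"
    by (rule Lim_null_comparison[OF _ n]) (simp add: cauchy_schwarz)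
  moreover have "(\<lambda>n. q (u n) v) \<longlonglongrightarrow> f v" using u by (simp add: represents_def)
  ultimately show "f v = 0 v" using LIMSEQ_unique by fastforce
qed

end

section \<open>Completeness of the completion\<close>

context semi_inner begin

text \<open>Each term of a Cauchy sequence of functionals is replaced by a nearby embedded vector;
  the chosen vectors form a Cauchy sequence in the original space, and the functional it represents
  is the limit.\<close>

lemma hilbert_space_completion: "hilbert_space scale_fun completion cip"
proof -
  interpret h: hermitian_form scale_fun completion cip by (rule hermitian_form_completion)
  have nn: "0 \<le> form_norm cip f" if "f \<in> completion" for f
    using cip_nonneg[OF that] by (auto simp: form_norm_def less_eq_complex_def)
  \<comment> \<open>The lemmas of \<open>hilbert_space\<close> presuppose completeness, so
    Cauchy-Schwarz and the triangle inequality are carried over from the original space by taking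
    limits.\<close>
  have CS: "cmod (cip f g) \<le> form_norm cip f * form_norm cip g"
    if fg: "f \<in> completion" "g \<in> completion" for f g
  proof -
    obtain u v where uv: "represents u f" "represents v g" using fg by (auto simp: completion_def)
    show ?thesis
      by (rule tendsto_le[OF _ tendsto_mult[OF represents_norm[OF uv(1)] represents_norm[OF uv(2)]]
            tendsto_norm[OF cip_eqI[OF uv]]]) (simp_all add: cauchy_schwarz)
  qed
  have tri: "form_norm cip (f + g) \<le> form_norm cip f + form_norm cip g"
    if fg: "f \<in> completion" "g \<in> completion" for f g
  proof -
    obtain u v where uv: "represents u f" "represents v g" using fg by (auto simp: completion_def)
    show ?thesis
      by (rule tendsto_le[OF _ tendsto_add[OF represents_norm[OF uv(1)] represents_norm[OF uv(2)]]
            represents_norm[OF represents_linear(1)[OF uv]]]) (simp_all add: norm_triangle)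
  qed
  have comm: "form_norm cip (f - g) = form_norm cip (g - f)"
    if "f \<in> completion" "g \<in> completion" for f g
    using that by (simp add: form_norm_def h.form_diff_left h.form_diff_right h.minus_in algebra_simps)
  interpret M: Metric_space completion "form_dist completion cip"
  proof
    fix f g k
    show "0 \<le> form_dist completion cip f g" by (simp add: form_dist_def nn h.minus_in)
    show "form_dist completion cip f g = form_dist completion cip g f"
      by (simp add: form_dist_def comm)
    show "form_dist completion cip f g = 0 \<longleftrightarrow> f = g" if "f \<in> completion" "g \<in> completion"
    proof
      assume "form_dist completion cip f g = 0"
      then have "cip (f - g) (f - g) = 0"
        using that cip_nonneg[OF h.minus_in[OF that]]
        by (auto simp: form_dist_def form_norm_def less_eq_complex_def complex_eq_iff)
      then show "f = g" using cip_definite h.minus_in that by fastforce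
    qed (use that in \<open>simp add: form_dist_def form_norm_def h.form_zero h.zero_in\<close>)
    show "form_dist completion cip f k \<le> form_dist completion cip f g + form_dist completion cip g k"
      if "f \<in> completion" "g \<in> completion" "k \<in> completion"
      using tri[of "f - g" "g - k"] that h.minus_in by (simp add: form_dist_def)
  qed
  have "M.mcomplete"
    unfolding M.mcomplete_def
  proof (intro allI impI)
    fix F assume F: "M.MCauchy F"
    then have FK: "F n \<in> completion" for n by (auto simp: M.MCauchy_def)
    have "\<exists>x. form_norm cip (F n - q x) < inverse (real (Suc n))" for n
    proof -
      obtain u where "represents u (F n)" using FK[of n] by (auto simp: completion_def)
      from order_tendstoD(2)[OF represents_approx[OF this], of "inverse (real (Suc n))"]
      show ?thesis by (auto simp: eventually_sequentially)
    qed
    then obtain x where x: "form_norm cip (F n - q (x n)) < inverse (real (Suc n))" for n by metis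
    have x0: "(\<lambda>n. form_norm cip (F n - q (x n))) \<longlonglongrightarrow> 0"
      by (rule tendsto_sandwich[OF _ _ tendsto_const LIMSEQ_inverse_real_of_nat])
        (intro always_eventually allI nn h.minus_in FK const_in less_imp_le[OF x])+
    have xx: "form_norm q (x m - x n) \<le> form_norm cip (F m - q (x m)) + form_norm cip (F m - F n)
        + form_norm cip (F n - q (x n))" for m n
    proof -
      have "form_norm q (x m - x n) = form_norm cip (q (x m) - q (x n))"
        by (simp add: form_norm_def h.form_diff_left h.form_diff_right h.minus_in const_in cip_const
            diff_left diff_right)
      also have "\<dots> \<le> form_norm cip (q (x m) - F m) + form_norm cip (F m - q (x n))"
        using tri[of "q (x m) - F m" "F m - q (x n)"] FK const_in h.minus_in by simp
      also have "\<dots> \<le> form_norm cip (q (x m) - F m) + (form_norm cip (F m - F n) + form_norm cip (F n - q (x n)))"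
        using tri[of "F m - F n" "F n - q (x n)"] FK const_in h.minus_in by simp
      finally show ?thesis using comm[OF FK const_in, of m "x m"] by simp
    qed
    have "cauchy x"
      unfolding cauchy_def
    proof (intro allI impI)
      fix e :: real assume e: "0 < e"
      obtain N where N: "\<And>n. n \<ge> N \<Longrightarrow> form_norm cip (F n - q (x n)) < e/3"
        using order_tendstoD(2)[OF x0, of "e/3"] e by (auto simp: eventually_sequentially)
      have "0 < e/3" using e by simp
      then obtain M where "\<And>m n. m \<ge> M \<Longrightarrow> n \<ge> M \<Longrightarrow> form_dist completion cip (F m) (F n) < e/3"
        using F unfolding M.MCauchy_def by blast
      then have M: "\<And>m n. m \<ge> M \<Longrightarrow> n \<ge> M \<Longrightarrow> form_norm cip (F m - F n) < e/3"
        using FK by (simp add: form_dist_def)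
      have "form_norm q (x m - x n) < e" if "m \<ge> max N M" "n \<ge> max N M" for m n
        using xx[of m n] N[of m] N[of n] M[of m n] that by simp
      then show "\<exists>N. \<forall>m\<ge>N. \<forall>n\<ge>N. form_norm q (x m - x n) < e" by blast
    qed
    then obtain f where f: "represents x f" by (rule cauchy_represents)
    then have fK: "f \<in> completion" by (auto simp: completion_def)
    have lim: "(\<lambda>n. form_norm cip (F n - q (x n)) + form_norm cip (f - q (x n))) \<longlonglongrightarrow> 0"
      using tendsto_add[OF x0 represents_approx[OF f]] by simp
    have le: "form_dist completion cip (F n) f
        \<le> form_norm cip (F n - q (x n)) + form_norm cip (f - q (x n))" for n
      using tri[of "F n - q (x n)" "q (x n) - f"] FK fK const_in h.minus_in comm[OF fK const_in]
      by (simp add: form_dist_def)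
    have "limitin M.mtopology F f sequentially"
      unfolding M.limit_metric_sequentially
    proof (intro conjI allI impI fK)
      fix e :: real assume "0 < e"
      then obtain N where "\<And>n. n \<ge> N \<Longrightarrow>
          form_norm cip (F n - q (x n)) + form_norm cip (f - q (x n)) < e"
        using order_tendstoD(2)[OF lim, of e] by (auto simp: eventually_sequentially)
      then show "\<exists>N. \<forall>n\<ge>N. F n \<in> completion \<and> form_dist completion cip (F n) f < e"
        using le FK by (meson le_less_trans)
    qed
    then show "\<exists>f. limitin M.mtopology F f sequentially" by blast
  qed
  then show ?thesis by unfold_locales (auto simp: cip_nonneg cip_definite)
qed

end

sublocale semi_inner \<subseteq> C: hilbert_space scale_fun completion cip
  by (rule hilbert_space_completion)

section \<open>Dual norm and Riesz representation\<close>

context semi_inner begin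

lemma norm_const: "form_norm cip (q x) = form_norm q x"
  by (simp add: form_norm_def cip_const)

lemma q_minus: "q (x - y) = q x - q y"
  by (simp add: fun_eq_iff diff_left)

lemma completion_bound:
  assumes "f \<in> completion" shows "cmod (f v) \<le> form_norm cip f * form_norm q v"
  using C.cauchy_schwarz[OF assms const_in, of v] by (simp add: cip_const_right assms norm_const)

lemma tendsto_cip:
  assumes "f \<in> completion" "g \<in> completion" "\<And>n. F n \<in> completion"
    and "(\<lambda>n. form_norm cip (g - F n)) \<longlonglongrightarrow> 0"
  shows "(\<lambda>n. cip f (F n)) \<longlonglongrightarrow> cip f g"
proof (rule Lim_transform2[OF tendsto_const], rule Lim_null_comparison)
  show "\<forall>\<^sub>F n in sequentially. norm (cip f g - cip f (F n)) \<le> form_norm cip f * form_norm cip (g - F n)"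
    using C.cauchy_schwarz[OF assms(1) C.minus_in[OF assms(2,3)]]
    by (simp add: C.form_diff_right assms)
  show "(\<lambda>n. form_norm cip f * form_norm cip (g - F n)) \<longlonglongrightarrow> 0"
    using tendsto_mult_left[OF assms(4)] by simp
qed

text \<open>Testing \<open>f\<close> against its own approximants \<open>u n\<close> exhibits
  \<open>cip f f\<close> as the limit of \<open>f (u n)\<close>. Together with
  \<open>completion_bound\<close> this identifies the norm of the completion as a dual norm, so that
  norm estimates need checking on original vectors only.\<close>

lemma completion_norm_le:
  assumes f: "f \<in> completion" and B: "\<And>v. cmod (f v) \<le> B * form_norm q v" "0 \<le> B"
  shows "form_norm cip f \<le> B"
proof -
  obtain u where u: "represents u f" using f by (auto simp: completion_def)
  have "(\<lambda>n. cip f (q (u n))) \<longlonglongrightarrow> cip f f"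
    by (intro tendsto_cip f const_in represents_approx u)
  then have "(\<lambda>n. norm (f (u n))) \<longlonglongrightarrow> norm (cip f f)"
    by (simp add: cip_const_right f tendsto_norm)
  from tendsto_le[OF _ tendsto_mult_left[OF represents_norm[OF u]] this]
  have "norm (cip f f) \<le> B * form_norm cip f" by (simp add: B)
  then have "(form_norm cip f)\<^sup>2 \<le> B * form_norm cip f"
    by (simp add: C.ip_real(1)[OF f] norm_power C.ip_real(2)[OF f])
  then show ?thesis
    using B(2) C.ip_real(2)[OF f] by (cases "form_norm cip f = 0") (auto simp: power2_eq_square)
qed

text \<open>Minimise \<open>\<parallel>v\<parallel>\<^sup>2 - 2 Re (\<phi> v)\<close>; minimising sequences are Cauchy.\<close>

lemma riesz:
  assumes add: "\<And>x y. \<phi> (x + y) = \<phi> x + \<phi> y" and sc: "\<And>c x. \<phi> (scale c x) = c * \<phi> x"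
    and B: "\<And>v. cmod (\<phi> v) \<le> B * form_norm q v"
  shows "(\<lambda>v. cnj (\<phi> v)) \<in> completion"
proof -
  define I where "I v = (form_norm q v)\<^sup>2 - 2 * Re (\<phi> v)" for v
  have I_ge: "- B\<^sup>2 \<le> I v" for v
  proof -
    have "0 \<le> (form_norm q v - B)\<^sup>2" by simp
    then show ?thesis using B[of v] complex_Re_le_cmod[of "\<phi> v"]
      by (simp add: I_def power2_diff mult.commute)
  qed
  define m where "m = Inf (range I)"
  have m: "m \<le> I v" for v
    unfolding m_def by (rule cINF_lower) (auto intro!: bdd_belowI2 I_ge)
  have "\<exists>x. I x < m + inverse (real (Suc n))" for n
    using cInf_lessD[of "range I" "m + inverse (real (Suc n))"] by (auto simp: m_def)
  then obtain x where x: "I (x n) < m + inverse (real (Suc n))" for n by metis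
  \<comment> \<open>Parallelogram identity, in which the linear part of \<open>I\<close> cancels.
    The midpoint has value at least \<open>m\<close>, so two near minimisers must be close.\<close>
  have par: "I y + I z = 2 * I (scale (1/2) (y + z)) + (form_norm q (y - z))\<^sup>2 / 2" for y z
    by (simp add: I_def norm_sq add sc scale_left scale_right add_left add_right diff_left diff_right
        field_simps)
  have xx: "(form_norm q (x k - x n))\<^sup>2 \<le> 2 * (inverse (real (Suc k)) + inverse (real (Suc n)))" for k n
    using par[of "x k" "x n"] m[of "scale (1/2) (x k + x n)"] x[of k] x[of n] by simp
  have "cauchy x"
    unfolding cauchy_def
  proof (intro allI impI)
    fix e :: real assume e: "0 < e"
    have "0 < e\<^sup>2/4" using e by simp
    then obtain N where N: "inverse (real (Suc N)) < e\<^sup>2/4" using reals_Archimedean by blast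
    have i: "inverse (real (Suc n)) < e\<^sup>2/4" if "n \<ge> N" for n
      by (rule le_less_trans[OF _ N]) (use that in \<open>simp add: le_imp_inverse_le\<close>)
    have "form_norm q (x k - x n) < e" if "k \<ge> N" "n \<ge> N" for k n
    proof (rule power_less_imp_less_base)
      show "(form_norm q (x k - x n))\<^sup>2 < e\<^sup>2" using xx[of k n] i[OF that(1)] i[OF that(2)] by argo
    qed (use e in simp)
    then show "\<exists>N. \<forall>m\<ge>N. \<forall>n\<ge>N. form_norm q (x m - x n) < e" by blast
  qed
  then obtain f where f: "represents x f" by (rule cauchy_represents)
  have lim: "(\<lambda>n. q (x n) v) \<longlonglongrightarrow> f v" for v using f by (simp add: represents_def)
  have Re: "Re (f v) = Re (\<phi> v)" for v
  proof -
    define d where "d = Re (f v) - Re (\<phi> v)"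
    define N where "N = (form_norm q v)\<^sup>2"
    have N: "0 \<le> N" by (simp add: N_def)
    \<comment> \<open>First-order condition: vary the near minimiser \<open>x n\<close> by a real
      multiple \<open>t\<close> of \<open>v\<close>, where at most \<open>inverse (Suc n)\<close>
      can be gained, then let \<open>n\<close> grow.\<close>
    have t: "0 \<le> 2 * t * d + t\<^sup>2 * N" for t
    proof -
      have "- inverse (real (Suc n)) \<le> 2 * t * (Re (q (x n) v) - Re (\<phi> v)) + t\<^sup>2 * N" for n
      proof -
        have "I (x n + scale (complex_of_real t) v)
            = I (x n) + (2 * t * (Re (q (x n) v) - Re (\<phi> v)) + t\<^sup>2 * N)"
          using cnj_form[of v "x n"]
          unfolding I_def N_def norm_sq
          by (simp add: add sc scale_left scale_right add_left add_right
              power2_eq_square algebra_simps complex_eq_iff)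
        then show ?thesis using m[of "x n + scale (complex_of_real t) v"] x[of n] by simp
      qed
      moreover have "(\<lambda>n. - inverse (real (Suc n))) \<longlonglongrightarrow> - 0"
        by (intro tendsto_minus LIMSEQ_inverse_real_of_nat)
      moreover have "(\<lambda>n. 2 * t * (Re (q (x n) v) - Re (\<phi> v)) + t\<^sup>2 * N) \<longlonglongrightarrow> 2 * t * d + t\<^sup>2 * N"
        unfolding d_def by (intro tendsto_intros lim)
      ultimately show ?thesis by (simp add: LIMSEQ_le)
    qed
    \<comment> \<open>With this \<open>r\<close> the value \<open>2 * r * d + r\<^sup>2 * N\<close>
      equals \<open>- ((N + 2) * r\<^sup>2)\<close>, which is nonnegative only for
      \<open>r = 0\<close>. The summand 1 avoids division by zero when \<open>N = 0\<close>.\<close>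
    define r where "r = - d / (N + 1)"
    have d: "d = - r * (N + 1)" using N by (simp add: r_def)
    have "0 \<le> - ((N + 2) * r\<^sup>2)"
      using t[of r] unfolding d by (simp add: algebra_simps power2_eq_square)
    then have "d = 0" using N d by (simp add: mult_le_0_iff)
    then show ?thesis by (simp add: d_def)
  qed
  \<comment> \<open>Real parts suffice: \<open>f\<close> is antilinear and \<open>\<phi>\<close>
    linear, so the real parts at \<open>scale \<i> v\<close> yield the imaginary parts at
    \<open>v\<close>.\<close>
  have "f v = cnj (\<phi> v)" for v
  proof -
    have "f (scale \<i> v) = - \<i> * f v"
      by (rule LIMSEQ_unique[OF lim]) (use tendsto_mult_left[OF lim[of v], of "- \<i>"] in \<open>simp add: scale_right\<close>)
    then show ?thesis using Re[of v] Re[of "scale \<i> v"] by (simp add: sc complex_eq_iff)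
  qed
  then have "f = (\<lambda>v. cnj (\<phi> v))" by blast
  then show ?thesis using f by (auto simp: completion_def)
qed

end

section \<open>Minimal majorants of a hermitian form\<close>

text \<open>Because of this formula, comparison of diagonals is antisymmetric on semi-inner
  products, and convergence on the diagonal entails convergence at all pairs.\<close>

lemma (in semi_inner) polarization:
  "q u v = (complex_of_real (Re (q (u + v) (u + v))) - complex_of_real (Re (q (u - v) (u - v)))
      + \<i> * (complex_of_real (Re (q (u + scale \<i> v) (u + scale \<i> v)))
        - complex_of_real (Re (q (u - scale \<i> v) (u - scale \<i> v))))) / 4"
  using cnj_form[of u v]
  by (simp add: add_left add_right diff_left diff_right scale_left scale_right complex_eq_iff)

locale krein_majorant = semi_inner scale q + b: hermitian_form scale UNIV b
  for scale :: "complex \<Rightarrow> 'v::ab_group_add \<Rightarrow> 'v" and q b +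
  assumes dom: "cmod (b u u) \<le> Re (q u u)"
begin

lemma b_linear:
  "b (x + y) = b x + b y" "b (scale c x) = scale_fun c (b x)"
  by (auto simp: b.form_add_left b.form_scale_left scale_fun_def fun_eq_iff)

lemma cnj_b: "cnj (b x y) = b y x"
  using b.form_cnj[of y x] by simp

lemma Im_b_self: "Im (b u u) = 0"
  using arg_cong[OF cnj_b[of u u], of Im] by simp

text \<open>Both \<open>q + b\<close> and \<open>q - b\<close> are positive; apply the Cauchy-Schwarz inequality to each.\<close>

lemma b_bound: "cmod (b u v) \<le> form_norm q u * form_norm q v"
proof -
  have 1: "semi_inner scale (\<lambda>x y. q x y + of_real e * b x y)" if e: "\<bar>e\<bar> = 1" for e :: real
  proof
    show "0 \<le> q x x + of_real e * b x x" for x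
      using dom[of x] abs_Re_le_cmod[of "b x x"] Im_b_self[of x] self_eq[of x] e
      by (auto simp: less_eq_complex_def abs_if split: if_splits)
  qed (auto simp: add_left b.form_add_left scale_left b.form_scale_left algebra_simps cnj_form cnj_b
      subspace_UNIV)
  interpret p: semi_inner scale "\<lambda>x y. q x y + b x y" using 1[of 1] by simp
  interpret m: semi_inner scale "\<lambda>x y. q x y - b x y" using 1[of "-1"] by simp
  let ?P = "form_norm (\<lambda>x y. q x y + b x y)" and ?M = "form_norm (\<lambda>x y. q x y - b x y)"
  have par: "(?P x)\<^sup>2 + (?M x)\<^sup>2 = 2 * (form_norm q x)\<^sup>2" for x
    by (simp add: p.norm_sq m.norm_sq norm_sq)
  have "2 * cmod (b u v) = cmod ((q u v + b u v) - (q u v - b u v))" by (simp add: norm_mult)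
  also have "\<dots> \<le> cmod (q u v + b u v) + cmod (q u v - b u v)" by (rule norm_triangle_ineq4)
  also have "\<dots> \<le> ?P u * ?P v + ?M u * ?M v" by (intro add_mono p.cauchy_schwarz m.cauchy_schwarz)
  also have "\<dots> \<le> 2 * (form_norm q u * form_norm q v)"
  proof (rule power2_le_imp_le)
    \<comment> \<open>Cauchy-Schwarz in the plane for \<open>(?P u, ?M u)\<close> and
      \<open>(?P v, ?M v)\<close>, whose squared lengths are given by \<open>par\<close>.\<close>
    have "(?P u * ?P v + ?M u * ?M v)\<^sup>2 \<le> ((?P u)\<^sup>2 + (?M u)\<^sup>2) * ((?P v)\<^sup>2 + (?M v)\<^sup>2)"
      using zero_le_power2[of "?P u * ?M v - ?M u * ?P v"]
      by (simp add: power2_eq_square algebra_simps)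
    also have "\<dots> = (2 * (form_norm q u * form_norm q v))\<^sup>2"
      unfolding par by (simp add: power_mult_distrib)
    finally show "(?P u * ?P v + ?M u * ?M v)\<^sup>2 \<le> (2 * (form_norm q u * form_norm q v))\<^sup>2" .
  qed simp
  finally show ?thesis by simp
qed

text \<open>As a vector of the completion, \<open>b u\<close> is G applied to \<open>q u\<close>;
  thus \<open>cip (b u) (b v)\<close> is the form of G^2. Since \<open>riesz\<close> expects a
  linear functional, it is applied to \<open>b v u\<close> as a function of
  \<open>v\<close>.\<close>

lemma b_in: "b u \<in> completion"
proof -
  have "(\<lambda>v. cnj (b v u)) \<in> completion"
    by (rule riesz[where B = "form_norm q u"])
      (use b_bound in \<open>auto simp: b.form_add_left b.form_scale_left mult.commute\<close>)
  then show ?thesis by (simp add: cnj_b)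
qed

lemma norm_b_le: "form_norm cip (b u) \<le> form_norm q u"
  by (rule completion_norm_le[OF b_in]) (simp_all add: b_bound)

text \<open>For the Gram operator \<open>G\<close> of \<open>b\<close> this is the form of \<open>(1 + G\<^sup>2) / 2 \<ge> \<bar>G\<bar>\<close>.\<close>

definition improved :: "'v \<Rightarrow> 'v \<Rightarrow> complex" where
  "improved u v = (q u v + cip (b u) (b v)) / 2"

lemma improved_self: "Re (improved u u) = ((form_norm q u)\<^sup>2 + (form_norm cip (b u))\<^sup>2) / 2"
  by (simp add: improved_def norm_sq C.ip_real(1)[OF b_in])

lemma improved_le: "Re (improved u u) \<le> Re (q u u)"
  using power_mono[OF norm_b_le C.ip_real(2)[OF b_in], of u 2] by (simp add: improved_self norm_sq)

text \<open>Domination survives by Cauchy-Schwarz, |b(u,u)| <= |G u| |u|, followed by the inequality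
  between arithmetic and geometric mean.\<close>

lemma krein_majorant_improved: "krein_majorant scale improved b"
proof -
  have "semi_inner scale improved"
  proof
    show "0 \<le> improved u u" for u
      using nonneg[of u] C.ip_nonneg[OF b_in, of u] by (simp add: improved_def less_eq_complex_def)
    show "improved x y = cnj (improved y x)" for x y
      using C.form_cnj[OF b_in b_in, of x y] by (simp add: improved_def cnj_form)
  qed (auto simp: improved_def b_linear add_left scale_left C.form_add_left C.form_scale_left b_in
      field_simps subspace_UNIV)
  moreover have "cmod (b u u) \<le> Re (improved u u)" for u
  proof -
    have "cmod (b u u) \<le> form_norm cip (b u) * form_norm q u" by (rule completion_bound[OF b_in])
    also have "\<dots> \<le> Re (improved u u)"
      using zero_le_power2[of "form_norm q u - form_norm cip (b u)"]
      by (simp add: improved_self power2_diff mult_ac)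
    finally show ?thesis .
  qed
  ultimately show ?thesis
    by (intro krein_majorant.intro krein_majorant_axioms.intro) (auto intro: b.hermitian_form_axioms)
qed

end

section \<open>Minimal majorants by Zorn's lemma\<close>

text \<open>The diagonals of a chain decrease to their infima, polarization extends the limit to all
  pairs, and the required conditions are equalities and weak inequalities, which pass to
  limits.\<close>

lemma krein_majorant_chain_lower_bound:
  fixes sc :: "complex \<Rightarrow> 'v::ab_group_add \<Rightarrow> 'v"
  assumes C: "\<And>q. q \<in> C \<Longrightarrow> krein_majorant sc q b" "C \<noteq> {}"
    and chain: "\<And>q r. q \<in> C \<Longrightarrow> r \<in> C \<Longrightarrow>
      (\<forall>u. Re (q u u) \<le> Re (r u u)) \<or> (\<forall>u. Re (r u u) \<le> Re (q u u))"
    and T: "\<And>q a u. q \<in> C \<Longrightarrow> Re (q (T a u) (T a u)) \<le> B a * Re (q u u)"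
  obtains Q where "krein_majorant sc Q b" "\<And>q u. q \<in> C \<Longrightarrow> Re (Q u u) \<le> Re (q u u)"
    "\<And>a u. Re (Q (T a u) (T a u)) \<le> B a * Re (Q u u)"
proof -
  \<comment> \<open>Filter of the lower tails of the chain: a limit along \<open>F\<close> is a
    limit towards ever smaller forms.\<close>
  define F where "F = (INF q\<in>C. principal {r \<in> C. \<forall>u. Re (r u u) \<le> Re (q u u)})"
  have ev: "eventually P F \<longleftrightarrow> (\<exists>q\<in>C. \<forall>r\<in>C. (\<forall>u. Re (r u u) \<le> Re (q u u)) \<longrightarrow> P r)" for P
  proof -
    have "\<exists>x\<in>C. principal {r \<in> C. \<forall>u. Re (r u u) \<le> Re (x u u)}
      \<le> inf (principal {r \<in> C. \<forall>u. Re (r u u) \<le> Re (q u u)})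
          (principal {r \<in> C. \<forall>u. Re (r u u) \<le> Re (q' u u)})" if "q \<in> C" "q' \<in> C" for q q'
      using chain[OF that] that by (auto simp: le_principal eventually_principal intro: order_trans)
    then have "eventually P F \<longleftrightarrow>
        (\<exists>q\<in>C. eventually P (principal {r \<in> C. \<forall>u. Re (r u u) \<le> Re (q u u)}))"
      unfolding F_def by (intro eventually_INF_base C(2))
    then show ?thesis unfolding eventually_principal by blast
  qed
  have inC: "eventually (\<lambda>q. q \<in> C) F" using C(2) by (auto simp: ev)
  have F: "F \<noteq> bot" unfolding trivial_limit_def ev by auto
  have sq: "semi_inner sc q" if "q \<in> C" for q using C(1)[OF that] by (simp add: krein_majorant_def)
  have "\<exists>l. ((\<lambda>q. Re (q u u)) \<longlongrightarrow> l) F" for u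
  proof
    let ?N = "(\<lambda>q. Re (q u u)) ` C"
    have bdd: "bdd_below ?N"
      using semi_inner.nonneg[OF sq] by (auto intro!: bdd_belowI2[of _ 0] simp: less_eq_complex_def)
    show "((\<lambda>q. Re (q u u)) \<longlongrightarrow> Inf ?N) F"
    proof (rule order_tendstoI)
      fix y assume "y < Inf ?N"
      then show "eventually (\<lambda>q. y < Re (q u u)) F"
        using inC by (rule_tac eventually_mono[OF inC]) (auto intro: less_le_trans cINF_lower[OF bdd])
    next
      fix y assume "Inf ?N < y"
      then obtain q where "q \<in> C" "Re (q u u) < y" using cInf_lessD[of ?N y] C(2) by auto
      then show "eventually (\<lambda>q. Re (q u u) < y) F"
        unfolding ev by (auto intro!: bexI[of _ q] intro: le_less_trans)
    qed
  qed
  then obtain N where N: "((\<lambda>q. Re (q u u)) \<longlongrightarrow> N u) F" for u by metis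
  \<comment> \<open>Only the diagonal is monotone along the chain, so the remaining values of the
    limit are defined by polarization from \<open>N\<close>.\<close>
  define Q where "Q u v = (complex_of_real (N (u + v)) - complex_of_real (N (u - v))
    + \<i> * (complex_of_real (N (u + sc \<i> v)) - complex_of_real (N (u - sc \<i> v)))) / 4" for u v
  have lim: "((\<lambda>q. q u v) \<longlongrightarrow> Q u v) F" for u v
  proof -
    have "((\<lambda>q. (complex_of_real (Re (q (u + v) (u + v))) - complex_of_real (Re (q (u - v) (u - v)))
      + \<i> * (complex_of_real (Re (q (u + sc \<i> v) (u + sc \<i> v)))
        - complex_of_real (Re (q (u - sc \<i> v) (u - sc \<i> v))))) / 4) \<longlongrightarrow> Q u v) F"
      unfolding Q_def by (intro tendsto_intros N) simp
    moreover have "eventually (\<lambda>q. (complex_of_real (Re (q (u + v) (u + v))) - complex_of_real (Re (q (u - v) (u - v)))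
      + \<i> * (complex_of_real (Re (q (u + sc \<i> v) (u + sc \<i> v)))
        - complex_of_real (Re (q (u - sc \<i> v) (u - sc \<i> v))))) / 4 = q u v) F"
      by (rule eventually_mono[OF inC]) (rule semi_inner.polarization[OF sq, symmetric])
    ultimately show ?thesis by (rule Lim_transform_eventually)
  qed
  have eqI: "x = y" if "(f \<longlongrightarrow> x) F" "(g \<longlongrightarrow> y) F" "\<And>q. q \<in> C \<Longrightarrow> f q = g q" for f g and x y :: complex
    by (rule tendsto_unique[OF F Lim_transform_eventually[OF that(1) eventually_mono[OF inC]] that(2)])
      (rule that(3))
  have leI: "x \<le> y" if "(f \<longlongrightarrow> x) F" "(g \<longlongrightarrow> y) F" "\<And>q. q \<in> C \<Longrightarrow> f q \<le> g q" for f g and x y :: real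
    by (rule tendsto_le[OF F that(2,1) eventually_mono[OF inC]]) (rule that(3))
  obtain q0 where q0: "q0 \<in> C" using C(2) by blast
  interpret q0: krein_majorant sc q0 b by (rule C(1)[OF q0])
  have "semi_inner sc Q"
  proof
    fix x y z :: 'v and c
    show "Q (x + y) z = Q x z + Q y z"
      by (rule eqI[OF lim tendsto_add[OF lim lim]]) (rule semi_inner.add_left[OF sq])
    show "Q (sc c x) z = c * Q x z"
      by (rule eqI[OF lim tendsto_mult_left[OF lim]]) (rule semi_inner.scale_left[OF sq])
    show "Q x y = cnj (Q y x)"
      by (rule eqI[OF lim tendsto_cnj[OF lim]]) (rule semi_inner.cnj_form[OF sq, symmetric])
    have "Im (Q x x) = 0"
      using eqI[OF lim tendsto_of_real[OF tendsto_Re[OF lim]], of x x x x] semi_inner.self_eq[OF sq]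
      by (metis Im_complex_of_real Re_complex_of_real)
    moreover have "0 \<le> Re (Q x x)"
      by (rule leI[OF tendsto_const tendsto_Re[OF lim]])
        (use semi_inner.nonneg[OF sq] in \<open>auto simp: less_eq_complex_def\<close>)
    ultimately show "0 \<le> Q x x" by (simp add: less_eq_complex_def)
  qed (simp add: q0.subspace_UNIV)
  moreover have "cmod (b u u) \<le> Re (Q u u)" for u
    by (rule leI[OF tendsto_const tendsto_Re[OF lim]]) (rule krein_majorant.dom[OF C(1)])
  ultimately have "krein_majorant sc Q b"
    by (intro krein_majorant.intro krein_majorant_axioms.intro) (auto intro: q0.b.hermitian_form_axioms)
  moreover have "Re (Q u u) \<le> Re (q u u)" if "q \<in> C" for q u
  proof (rule tendsto_upperbound[OF tendsto_Re[OF lim] _ F])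
    show "eventually (\<lambda>r. Re (r u u) \<le> Re (q u u)) F" using that by (auto simp: ev)
  qed
  moreover have "Re (Q (T a u) (T a u)) \<le> B a * Re (Q u u)" for a u
    by (rule leI[OF tendsto_Re[OF lim] tendsto_mult_left[OF tendsto_Re[OF lim]]]) (rule T)
  ultimately show ?thesis by (rule that)
qed

lemma minimal_krein_majorant:
  fixes sc :: "complex \<Rightarrow> 'v::ab_group_add \<Rightarrow> 'v"
  assumes q0: "krein_majorant sc q0 b" "\<And>a u. Re (q0 (T a u) (T a u)) \<le> B a * Re (q0 u u)"
  obtains q where "krein_majorant sc q b" "\<And>a u. Re (q (T a u) (T a u)) \<le> B a * Re (q u u)"
    "\<And>r. krein_majorant sc r b \<Longrightarrow> (\<And>a u. Re (r (T a u) (T a u)) \<le> B a * Re (r u u)) \<Longrightarrow>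
      (\<And>u. Re (r u u) \<le> Re (q u u)) \<Longrightarrow> r = q"
proof -
  define A where "A = {q. krein_majorant sc q b \<and> (\<forall>a u. Re (q (T a u) (T a u)) \<le> B a * Re (q u u))}"
  \<comment> \<open>The order is reversed: \<open>P q r\<close> puts \<open>r\<close> below
    \<open>q\<close>, so a maximal element for \<open>P\<close> is a minimal form.\<close>
  define P where "P q r \<longleftrightarrow> (\<forall>u. Re (r u u) \<le> Re (q u u))" for q r :: "'v \<Rightarrow> 'v \<Rightarrow> complex"
  have anti: "q = r" if "q \<in> A" "r \<in> A" "P q r" "P r q" for q r
  proof -
    interpret q: krein_majorant sc q b using that by (simp add: A_def)
    interpret r: krein_majorant sc r b using that by (simp add: A_def)
    have "Re (q u u) = Re (r u u)" for u using that by (simp add: P_def order_antisym)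
    then have "q u v = r u v" for u v
      unfolding q.polarization[of u v] r.polarization[of u v] by simp
    then show ?thesis by blast
  qed
  have "partial_order_on A (relation_of P A)"
    by (rule partial_order_on_relation_ofI) (use anti in \<open>auto simp: P_def intro: order_trans\<close>)
  moreover have "\<exists>Q\<in>A. \<forall>q\<in>C. P q Q" if C: "C \<in> Chains (relation_of P A)" for C
  proof (cases "C = {}")
    case True then show ?thesis using q0 by (auto simp: A_def)
  next
    case False
    have CA: "q \<in> A" if "q \<in> C" for q using C that by (auto simp: Chains_def relation_of_def)
    show ?thesis
    proof (rule krein_majorant_chain_lower_bound[of C sc b T B])
      show "(\<forall>u. Re (q u u) \<le> Re (r u u)) \<or> (\<forall>u. Re (r u u) \<le> Re (q u u))" if "q \<in> C" "r \<in> C" for q r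
        using C that by (auto simp: Chains_def relation_of_def P_def)
      fix Q assume "krein_majorant sc Q b" "\<And>q u. q \<in> C \<Longrightarrow> Re (Q u u) \<le> Re (q u u)"
        "\<And>a u. Re (Q (T a u) (T a u)) \<le> B a * Re (Q u u)"
      then show ?thesis by (intro bexI[of _ Q]) (auto simp: P_def A_def)
    qed (use CA False in \<open>auto simp: A_def\<close>)
  qed
  ultimately obtain q where "q \<in> A" "\<forall>r\<in>A. P q r \<longrightarrow> r = q"
    using predicate_Zorn[of A P] by blast
  then show ?thesis by (intro that[of q]) (auto simp: A_def P_def)
qed

text \<open>By minimality \<open>improved = q\<close>, that is \<open>G\<^sup>2 = 1\<close> for the Gram operator \<open>G\<close>.\<close>

lemma isometric_krein_majorant_exists:
  fixes sc :: "complex \<Rightarrow> 'v::ab_group_add \<Rightarrow> 'v"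
  assumes q0: "krein_majorant sc q0 b" "\<And>a u. Re (q0 (T a u) (T a u)) \<le> B a * Re (q0 u u)"
    and adj: "\<And>a u v. b (T a u) v = b u (T (st a) v)" and B: "\<And>a. B (st a) = B a" and B_nonneg: "\<And>a. 0 \<le> B a"
  obtains q where "krein_majorant sc q b" "\<And>a u. Re (q (T a u) (T a u)) \<le> B a * Re (q u u)"
    "\<And>u v. semi_inner.cip q (b u) (b v) = q u v"
proof -
  obtain q where q: "krein_majorant sc q b" "\<And>a u. Re (q (T a u) (T a u)) \<le> B a * Re (q u u)"
    and min: "\<And>r. krein_majorant sc r b \<Longrightarrow> (\<And>a u. Re (r (T a u) (T a u)) \<le> B a * Re (r u u)) \<Longrightarrow>
      (\<And>u. Re (r u u) \<le> Re (q u u)) \<Longrightarrow> r = q"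
    using minimal_krein_majorant[OF q0] by metis
  interpret krein_majorant sc q b by (rule q)
  have T: "form_norm q (T a u) \<le> sqrt (B a) * form_norm q u" for a u
    using q(2)[of a u] by (simp add: form_norm_def real_sqrt_mult[symmetric])
  \<comment> \<open>Duality moves \<open>T a\<close> to the other argument as
    \<open>T (star a)\<close>. Because \<open>B (star a) = B a\<close>, the constant on the vectors
    \<open>b u\<close> is the one valid for \<open>q\<close>, which keeps \<open>improved\<close>
    inside the class.\<close>
  have bT: "form_norm cip (b (T a u)) \<le> sqrt (B a) * form_norm cip (b u)" for a u
  proof (rule completion_norm_le[OF b_in])
    fix v
    have "cmod (b (T a u) v) \<le> form_norm cip (b u) * form_norm q (T (st a) v)"
      unfolding adj by (rule completion_bound[OF b_in])
    also have "\<dots> \<le> form_norm cip (b u) * (sqrt (B a) * form_norm q v)"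
      using T[of "st a" v] C.ip_real(2)[OF b_in] by (simp add: B mult_left_mono)
    finally show "cmod (b (T a u) v) \<le> sqrt (B a) * form_norm cip (b u) * form_norm q v"
      by (simp add: mult_ac)
  qed (simp add: C.ip_real(2)[OF b_in] B_nonneg)
  have "improved = q"
  proof (rule min[OF krein_majorant_improved _ improved_le])
    fix a u
    have "(form_norm cip (b (T a u)))\<^sup>2 \<le> B a * (form_norm cip (b u))\<^sup>2"
      using power_mono[OF bT C.ip_real(2)[OF b_in], of a u 2] B_nonneg[of a]
      by (simp add: power_mult_distrib)
    then show "Re (improved (T a u) (T a u)) \<le> B a * Re (improved u u)"
      using q(2)[of a u] by (simp add: improved_self norm_sq algebra_simps)
  qed
  then have "improved u v = q u v" for u v by simp
  then have "cip (b u) (b v) = q u v" for u v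
    unfolding improved_def by (metis add_diff_cancel_left' divide_eq_eq_numeral1(1) mult_2_right zero_neq_numeral)
  then show ?thesis using q by (intro that)
qed

section \<open>The Krein space of an isometric majorant\<close>

locale isometric_krein_majorant = krein_majorant scale q b
  for scale :: "complex \<Rightarrow> 'v::ab_group_add \<Rightarrow> 'v" and q b +
  assumes cip_b: "cip (b u) (b v) = q u v"
begin

text \<open>G extended to the whole completion through self-adjointness: \<open>symm f\<close> pairs
  with \<open>q v\<close> as \<open>f\<close> pairs with \<open>b v\<close>, the vector G (q
  v).\<close>

definition symm :: "('v \<Rightarrow> complex) \<Rightarrow> 'v \<Rightarrow> complex" where
  "symm f = (\<lambda>v. cip f (b v))"

lemma form_norm_b: "form_norm cip (b u) = form_norm q u"
  by (simp add: form_norm_def cip_b)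

lemma symm_in: assumes "f \<in> completion" shows "symm f \<in> completion"
proof -
  have "(\<lambda>v. cnj (cnj (cip f (b v)))) \<in> completion"
  proof (rule riesz[where B = "form_norm cip f"])
    show "cmod (cnj (cip f (b v))) \<le> form_norm cip f * form_norm q v" for v
      using C.cauchy_schwarz[OF assms b_in, of v] by (simp add: form_norm_b)
  qed (simp_all add: b_linear C.form_add_right C.form_scale_right b_in assms)
  then show ?thesis by (simp add: symm_def)
qed

lemma symm_q: "symm (q u) = b u"
proof
  fix v
  have "symm (q u) v = cnj (cip (b v) (q u))"
    unfolding symm_def by (rule C.form_cnj[OF const_in b_in])
  then show "symm (q u) v = b u v" by (simp add: cip_const_right b_in cnj_b)
qed

text \<open>This is G^2 = 1 on embedded vectors, read off from the isometry assumption
  \<open>cip_b\<close>.\<close>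

lemma symm_b: "symm (b u) = q u"
  by (simp add: symm_def cip_b)

lemma symm_norm_le: assumes "f \<in> completion" shows "form_norm cip (symm f) \<le> form_norm cip f"
proof (rule completion_norm_le[OF symm_in[OF assms]])
  show "cmod (symm f v) \<le> form_norm cip f * form_norm q v" for v
    using C.cauchy_schwarz[OF assms b_in, of v] by (simp add: symm_def form_norm_b)
qed (rule C.ip_real(2)[OF assms])

lemma symm_diff: "f \<in> completion \<Longrightarrow> g \<in> completion \<Longrightarrow> symm (f - g) = symm f - symm g"
  by (simp add: symm_def fun_eq_iff C.form_diff_left b_in)

text \<open>Against embedded vectors the identity is the definition of \<open>symm\<close> combined
  with \<open>symm_q\<close>; density and the contractivity \<open>symm_norm_le\<close> extend it to
  all \<open>g\<close>.\<close>

lemma symm_selfadjoint: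
  assumes f: "f \<in> completion" and g: "g \<in> completion"
  shows "cip (symm f) g = cip f (symm g)"
proof -
  obtain u where "represents u g" using g by (auto simp: completion_def)
  then have u: "(\<lambda>n. form_norm cip (g - q (u n))) \<longlonglongrightarrow> 0" by (rule represents_approx)
  have "(\<lambda>n. form_norm cip (symm g - symm (q (u n)))) \<longlonglongrightarrow> 0"
    using symm_norm_le[OF C.minus_in[OF g const_in]] C.ip_real(2)[OF symm_in[OF C.minus_in[OF g const_in]]]
    by (intro tendsto_sandwich[OF _ _ tendsto_const u])
      (simp_all add: symm_diff[OF g const_in, symmetric])
  then have "(\<lambda>n. cip f (symm (q (u n)))) \<longlonglongrightarrow> cip f (symm g)"
    by (intro tendsto_cip f g symm_in const_in)
  moreover have "(\<lambda>n. cip (symm f) (q (u n))) \<longlonglongrightarrow> cip (symm f) g"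
    by (intro tendsto_cip symm_in f g const_in u)
  moreover have "cip (symm f) (q v) = cip f (symm (q v))" for v
    by (simp add: symm_q cip_const_right symm_in f) (simp add: symm_def)
  ultimately show ?thesis using LIMSEQ_unique by simp
qed

lemma symm_symm: assumes "f \<in> completion" shows "symm (symm f) = f"
proof
  fix v
  have "symm (symm f) v = cip f (symm (b v))"
    unfolding symm_def[of "symm f"] by (rule symm_selfadjoint[OF assms b_in])
  then show "symm (symm f) v = f v" by (simp add: symm_b cip_const_right assms)
qed

definition kip :: "('v \<Rightarrow> complex) \<Rightarrow> ('v \<Rightarrow> complex) \<Rightarrow> complex" where
  "kip f g = cip (symm f) g"

lemma kip_const: "kip (q u) (q v) = b u v"
  by (simp add: kip_def symm_q cip_const_right b_in)

lemma krein_space_completion: "krein_space scale_fun completion kip cip symm"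
proof
  fix f g h c assume f: "f \<in> completion" and g: "g \<in> completion"
  have add: "symm (f + g) = symm f + symm g" and sc: "symm (scale_fun c f) = scale_fun c (symm f)"
    by (simp_all add: symm_def fun_eq_iff C.form_add_left C.form_scale_left b_in f g
        scale_fun_def[of c "\<lambda>v. cip f (b v)"])
  then show "symm (f + g) = symm f + symm g" "symm (scale_fun c f) = scale_fun c (symm f)" .
  show "kip (scale_fun c f) g = c * kip f g"
    by (simp add: kip_def sc C.form_scale_left symm_in f g)
  show "kip f g = cnj (kip g f)"
    unfolding kip_def symm_selfadjoint[OF f g] by (rule C.form_cnj[OF f symm_in[OF g]])
  show "kip (f + g) h = kip f h + kip g h" if "h \<in> completion"
    using that by (simp add: kip_def add C.form_add_left symm_in f g)
qed (simp_all add: kip_def symm_in symm_selfadjoint symm_symm C.subspace_K)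

end

section \<open>Operators intertwining a hermitian form\<close>

lemma (in hermitian_form) form_sum:
  assumes "finite S" "\<And>i. i \<in> S \<Longrightarrow> f i \<in> K" "z \<in> K"
  shows "form (\<Sum>i\<in>S. scale (c i) (f i)) z = (\<Sum>i\<in>S. c i * form (f i) z)"
    "form z (\<Sum>i\<in>S. scale (c i) (f i)) = (\<Sum>i\<in>S. cnj (c i) * form z (f i))"
proof -
  have *: "(\<Sum>i\<in>F. scale (c i) (f i)) \<in> K" if "F \<subseteq> S" for F
    using assms that by (auto intro!: subspace_sum subspace_scale subspace_K)
  have "F \<subseteq> S \<Longrightarrow> form (\<Sum>i\<in>F. scale (c i) (f i)) z = (\<Sum>i\<in>F. c i * form (f i) z)
    \<and> form z (\<Sum>i\<in>F. scale (c i) (f i)) = (\<Sum>i\<in>F. cnj (c i) * form z (f i))" if "finite F" for F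
    using that
  proof (induction F)
    case (insert i F)
    then show ?case using * assms
      by (simp add: form_add_left form_add_right form_scale_left form_scale_right
          subspace_scale subspace_K)
  qed (simp add: form_zero assms)
  then show "form (\<Sum>i\<in>S. scale (c i) (f i)) z = (\<Sum>i\<in>S. c i * form (f i) z)"
    "form z (\<Sum>i\<in>S. scale (c i) (f i)) = (\<Sum>i\<in>S. cnj (c i) * form z (f i))"
    using assms(1) by auto
qed

lemma (in hermitian_form) form_sum_sum:
  assumes "finite S" "\<And>i. i \<in> S \<Longrightarrow> f i \<in> K"
  shows "form (\<Sum>i\<in>S. scale (c i) (f i)) (\<Sum>i\<in>S. scale (c i) (f i))
    = (\<Sum>i\<in>S. \<Sum>j\<in>S. cnj (c i) * c j * form (f j) (f i))"
proof -
  have *: "(\<Sum>i\<in>S. scale (c i) (f i)) \<in> K"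
    using assms by (auto intro!: subspace_sum subspace_scale subspace_K)
  show ?thesis
    by (simp add: form_sum assms * sum_distrib_left mult.assoc)
qed

text \<open>Two points of the graph closure over the same \<open>x\<close> are approximated by
  \<open>(v, T v)\<close> and \<open>(w, T w)\<close> with \<open>v\<close> and \<open>w\<close>
  near \<open>x\<close>; boundedness then forces \<open>T v\<close> and \<open>T w\<close>
  together.\<close>

lemma (in hilbert_space) bounded_closable:
  assumes D: "subspace D" "D \<subseteq> K" and T: "\<And>x. x \<in> D \<Longrightarrow> T x \<in> K"
    and diff: "\<And>x y. x \<in> D \<Longrightarrow> y \<in> D \<Longrightarrow> T (x - y) = T x - T y"
    and bdd: "bounded_operator ip D T"
  shows "closable_operator K ip D T"
  unfolding closable_operator_def
proof (rule single_valuedI)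
  let ?X = "form_topology K ip"
  let ?cl = "prod_topology ?X ?X closure_of {(x, T x) |x. x \<in> D}"
  obtain C0 where C0: "\<And>x. x \<in> D \<Longrightarrow> form_norm ip (T x) \<le> C0 * form_norm ip x"
    using bdd by (auto simp: bounded_operator_def)
  \<comment> \<open>The constant in \<open>bounded_operator\<close> carries no sign; estimates can
    be multiplied by the maximum with 0.\<close>
  define C where "C = max C0 0"
  have C: "0 \<le> C" "form_norm ip (T x) \<le> C * form_norm ip x" if "x \<in> D" for x
    using C0[OF that] mult_right_mono[of C0 C "form_norm ip x"] ip_real(2)[of x] that D
    by (auto simp: C_def)
  have C': "0 \<le> C" by (simp add: C_def)
  have top: "topspace ?X = K" by (simp add: form_topology_eq)
  fix x y z assume xy: "(x, y) \<in> ?cl" and xz: "(x, z) \<in> ?cl"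
  have K: "x \<in> K" "y \<in> K" "z \<in> K"
    using xy xz by (auto simp: in_closure_of top)
  have approx: "\<exists>w\<in>D. form_dist K ip x w < e \<and> form_dist K ip y' (T w) < e"
    if "(x, y') \<in> ?cl" "0 < e" "y' \<in> K" for y' e
  proof -
    have "\<forall>U. (x, y') \<in> U \<and> openin (prod_topology ?X ?X) U \<longrightarrow> (\<exists>p. p \<in> {(x, T x) |x. x \<in> D} \<and> p \<in> U)"
      using that(1) unfolding in_closure_of by (rule conjunct2)
    moreover have "openin (prod_topology ?X ?X) (Met.mball x e \<times> Met.mball y' e)"
      by (simp add: openin_prod_Times_iff form_topology_eq)
    moreover have "(x, y') \<in> Met.mball x e \<times> Met.mball y' e" using that K by simp
    ultimately have "\<exists>p. p \<in> {(x, T x) |x. x \<in> D} \<and> p \<in> Met.mball x e \<times> Met.mball y' e"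
      by (elim allE impE) (rule conjI)
    then show ?thesis by auto
  qed
  show "y = z"
  proof (rule ccontr)
    assume "y \<noteq> z"
    then have d: "0 < form_dist K ip y z" using K Met.mdist_pos_less by blast
    \<comment> \<open>Chosen so that the three errors \<open>e\<close>, \<open>2 * e * C\<close> and
      \<open>e\<close> add up to half the distance from \<open>y\<close> to
      \<open>z\<close>.\<close>
    define e where "e = form_dist K ip y z / (1 + C) / 4"
    have e: "0 < e" using d C' by (simp add: e_def)
    obtain v where v: "v \<in> D" "form_dist K ip x v < e" "form_dist K ip y (T v) < e"
      using approx[OF xy e K(2)] by blast
    obtain w where w: "w \<in> D" "form_dist K ip x w < e" "form_dist K ip z (T w) < e"
      using approx[OF xz e K(3)] by blast
    have vw: "v \<in> K" "w \<in> K" "T v \<in> K" "T w \<in> K" "v - w \<in> D"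
      using v w D T subspace_diff by auto
    have "form_dist K ip v w \<le> form_dist K ip x v + form_dist K ip x w"
      using Met.triangle'[of v x w] vw K by (simp add: Met.commute)
    then have "form_dist K ip v w \<le> 2 * e" using v w by simp
    then have "form_dist K ip (T v) (T w) \<le> C * (2 * e)"
      using C(2)[OF vw(5)] mult_left_mono[OF _ C', of "form_dist K ip v w" "2 * e"] vw
      by (simp add: form_dist_def diff v w)
    moreover have "form_dist K ip y z \<le> form_dist K ip y (T v) + form_dist K ip (T v) (T w) + form_dist K ip z (T w)"
      using Met.triangle[of y "T v" z] Met.triangle[of "T v" "T w" z] Met.commute[of "T w" z] vw K by simp
    ultimately have "form_dist K ip y z < 2 * e * (1 + C)" using v w by (simp add: algebra_simps)
    moreover have "1 + C \<noteq> 0" using C' by simp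
    then have "2 * e * (1 + C) = form_dist K ip y z / 2" unfolding e_def by (simp add: field_simps del: distrib_left_numeral)
    ultimately show False using d by simp
  qed
qed

text \<open>Linearity in the algebra element is demanded only under \<open>b\<close>: on the free
  vector space \<open>T (a + a') u\<close> and \<open>T a u + T a' u\<close> differ in
  general.\<close>

locale intertwining_operators = isometric_krein_majorant scale q b + alg: complex_star_algebra scaleA star
  for scale :: "complex \<Rightarrow> 'v::ab_group_add \<Rightarrow> 'v" and q b
    and scaleA :: "complex \<Rightarrow> 'a::ring_1 \<Rightarrow> 'a" and star +
  fixes T :: "'a \<Rightarrow> 'v \<Rightarrow> 'v" and B :: "'a \<Rightarrow> real" and \<omega> :: 'v
  assumes T_add: "T a (u + v) = T a u + T a v"
    and T_scale: "T a (scale c u) = scale c (T a u)"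
    and T_bound: "form_norm q (T a u) \<le> B a * form_norm q u"
    and T_adj: "b (T a u) v = b u (T (star a) v)"
    and bT_add: "b (T (a + a') u) v = b (T a u) v + b (T a' u) v"
    and bT_scale: "b (T (scaleA c a) u) v = c * b (T a u) v"
    and T_mult: "T (a * a') u = T a (T a' u)"
    and T_cyclic: "span (range (\<lambda>a. T a \<omega>)) = UNIV"
begin

definition rep :: "'a \<Rightarrow> ('v \<Rightarrow> complex) \<Rightarrow> 'v \<Rightarrow> complex" where
  "rep a f = q (T a (SOME u. q u = f))"

lemma q_linear: "q (x + y) = q x + q y" "q (scale c x) = scale_fun c (q x)"
  by (auto simp: add_left scale_left scale_fun_def fun_eq_iff)

text \<open>Nondegeneracy: \<open>symm\<close> recovers \<open>q x\<close> from \<open>b x\<close>.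
  It turns identities known only under \<open>b\<close> into identities in the completion.\<close>

lemma q_eqI: "b x = b y \<Longrightarrow> q x = q y"
  using symm_b by metis

lemma T_diff: "T a (u - v) = T a u - T a v"
  using T_add[of a "u - v" v] by simp

text \<open>The choice made in \<open>rep\<close> is immaterial: vectors with the same image under
  \<open>q\<close> differ by a null vector, and by \<open>T_bound\<close> null vectors go to null
  vectors.\<close>

lemma rep_q: "rep a (q u) = q (T a u)"
proof -
  define v where "v = (SOME v. q v = q u)"
  have "q v = q u" unfolding v_def by (rule someI[of _ u]) simp
  then have "form_norm q (v - u) = 0" by (simp add: form_norm_def diff_left)
  then have "form_norm q (T a (v - u)) = 0"
    using T_bound[of a "v - u"] norm_nonneg[of "T a (v - u)"] by simp
  then have "form_norm cip (q (T a v) - q (T a u)) = 0"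
    by (simp add: T_diff norm_const flip: q_minus)
  then have "q (T a v) - q (T a u) = 0"
    using C.ip_real(1)[OF C.minus_in[OF const_in const_in]]
    by (intro cip_definite C.minus_in const_in) simp
  then show ?thesis by (simp add: rep_def v_def)
qed

lemma dense: "form_topology completion cip closure_of range q = completion"
proof -
  have "f \<in> C.Met.mtopology closure_of range q" if f: "f \<in> completion" for f
  proof -
    obtain u where "represents u f" using f by (auto simp: completion_def)
    from represents_approx[OF this] have u: "(\<lambda>n. form_norm cip (f - q (u n))) \<longlonglongrightarrow> 0" .
    have "\<exists>g\<in>range q. g \<in> C.Met.mball f e" if e: "0 < e" for e
    proof -
      obtain n where "form_norm cip (f - q (u n)) < e"
        using order_tendstoD(2)[OF u e] by (auto simp: eventually_sequentially)
      then show ?thesis using f const_in by (auto simp: form_dist_def)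
    qed
    then show ?thesis using f by (auto simp: C.Met.metric_closure_of)
  qed
  then show ?thesis
    using closure_of_subset_topspace[of C.Met.mtopology "range q"] by (auto simp: C.form_topology_eq)
qed

lemma rep_bounded: "bounded_operator cip (range q) (rep a)"
  unfolding bounded_operator_def using T_bound by (auto simp: rep_q norm_const intro!: exI[of _ "B a"])

text \<open>Testing with \<open>q v\<close> sees \<open>g\<close> through
  \<open>cip (b v) g\<close>, the conjugate of \<open>symm g v\<close>; the adjoint relation
  therefore fixes \<open>symm g\<close>, and \<open>symm_symm\<close> fixes
  \<open>g\<close>.\<close>

lemma adjoint_rel:
  "krein_adjoint_rel completion kip (range q) (rep a) (q u) g \<longleftrightarrow> g = q (T (star a) u)"
proof
  assume g: "krein_adjoint_rel completion kip (range q) (rep a) (q u) g"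
  then have gK: "g \<in> completion" by (simp add: krein_adjoint_rel_def)
  have "symm g v = symm (q (T (star a) u)) v" for v
  proof -
    have "kip (q v) g = kip (rep a (q v)) (q u)" using g by (simp add: krein_adjoint_rel_def)
    also have "\<dots> = kip (q v) (q (T (star a) u))" by (simp add: rep_q kip_const T_adj)
    finally have "cip (b v) g = cip (b v) (q (T (star a) u))" by (simp add: kip_def symm_q)
    then show ?thesis
      using C.form_cnj[OF gK b_in, of v] C.form_cnj[OF const_in b_in, of "T (star a) u" v]
      by (simp add: symm_def)
  qed
  then have "symm g = symm (q (T (star a) u))" by blast
  then show "g = q (T (star a) u)" using symm_symm[OF gK] symm_symm[OF const_in] by metis
qed (auto simp: krein_adjoint_rel_def rep_q kip_const T_adj const_in)

lemma bounded_gns_data: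
  assumes Z: "\<And>a. Z a = b (T a \<omega>) \<omega>"
  shows "bounded_gns_data scaleA star scale_fun completion kip cip symm (range q) rep Z (q \<omega>)"
proof -
  interpret k: krein_space scale_fun completion kip cip symm by (rule krein_space_completion)
  have sub: "C.subspace (range q)"
  proof (rule C.subspaceI)
    have "q 0 = 0" by (simp add: fun_eq_iff zero)
    then show "0 \<in> range q" by (metis rangeI)
  qed (auto simp flip: q_linear)
  have q_linear': "q x + q y = q (x + y)" "scale_fun c (q x) = q (scale c x)" for x y c
    by (simp_all add: q_linear)
  interpret c: closable_representation scaleA star scale_fun completion kip cip symm "range q" rep
  proof
    show "closable_operator completion cip (range q) (rep a)" for a
      by (rule C.bounded_closable[OF sub _ _ _ rep_bounded])
        (auto simp: const_in rep_q T_diff simp flip: q_minus)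
    have "q (T (a + a') u) = q (T a u + T a' u)" for a a' u
      by (rule q_eqI) (simp add: b_linear bT_add fun_eq_iff)
    then show "rep (a + a') f = rep a f + rep a' f" if "f \<in> range q" for a a' f
      using that by (auto simp: rep_q q_linear')
    have "q (T (scaleA c a) u) = q (scale c (T a u))" for a c u
      by (rule q_eqI) (simp add: b_linear bT_scale fun_eq_iff scale_fun_def)
    then show "rep (scaleA c a) f = scale_fun c (rep a f)" if "f \<in> range q" for a c f
      using that by (auto simp: rep_q q_linear')
  qed (auto simp: sub const_in dense rep_q q_linear' T_add T_scale T_mult)
  interpret r: hermitian_representation scaleA star scale_fun completion kip cip symm "range q" rep
  proof
    show "range q \<subseteq> krein_adjoint_dom completion kip (range q) (rep a)" for a
      by (auto simp: krein_adjoint_dom_def adjoint_rel)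
    show "krein_adjoint completion kip (range q) (rep a) f = rep (star a) f" if "f \<in> range q" for a f
      using that by (auto simp: krein_adjoint_def adjoint_rel rep_q)
  qed
  have "C.span (range (\<lambda>a. rep a (q \<omega>))) = range q"
  proof
    show "C.span (range (\<lambda>a. rep a (q \<omega>))) \<subseteq> range q"
      by (rule C.span_minimal) (auto simp: rep_q sub)
    have "q u \<in> C.span (range (\<lambda>a. rep a (q \<omega>)))" if "u \<in> span (range (\<lambda>a. T a \<omega>))" for u
      using that
    proof (induction rule: span_induct_alt)
      case base
      have "q 0 = 0" by (simp add: fun_eq_iff zero)
      then show ?case using C.span_zero by metis
    next
      case (step c x y)
      then show ?case
        unfolding q_linear by (intro C.span_add C.span_scale) (auto simp: rep_q intro!: C.span_base)
    qed
    then show "range q \<subseteq> C.span (range (\<lambda>a. rep a (q \<omega>)))" by (auto simp: T_cyclic)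
  qed
  then show ?thesis
    by unfold_locales (auto simp: rep_q kip_const Z rep_bounded)
qed

end

section \<open>Forms on the free vector space\<close>

definition pscale :: "complex \<Rightarrow> ('a \<Rightarrow>\<^sub>0 complex) \<Rightarrow> 'a \<Rightarrow>\<^sub>0 complex" where
  "pscale c u = Poly_Mapping.map ((*) c) u"

lemma lookup_pscale: "Poly_Mapping.lookup (pscale c u) x = c * Poly_Mapping.lookup u x"
  by (simp add: pscale_def Poly_Mapping.map.rep_eq when_def)

lemma vector_space_pscale: "vector_space pscale"
  by unfold_locales (auto intro!: poly_mapping_eqI simp: lookup_pscale lookup_add algebra_simps)

lemma poly_mapping_eq_sum_single:
  "u = (\<Sum>x\<in>Poly_Mapping.keys u. pscale (Poly_Mapping.lookup u x) (Poly_Mapping.single x 1))"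
  by (rule poly_mapping_eqI)
    (auto simp: lookup_sum lookup_pscale lookup_single when_def in_keys_iff if_distrib sum.delta cong: if_cong)

definition lin_ext :: "(complex \<Rightarrow> 'b \<Rightarrow> 'b::ab_group_add) \<Rightarrow> ('i \<Rightarrow> 'b) \<Rightarrow> ('i \<Rightarrow>\<^sub>0 complex) \<Rightarrow> 'b" where
  "lin_ext s g u = (\<Sum>x\<in>Poly_Mapping.keys u. s (Poly_Mapping.lookup u x) (g x))"

lemma linear_lin_ext:
  assumes "vector_space s" shows "Vector_Spaces.linear pscale s (lin_ext s g)"
proof -
  interpret P: vector_space pscale by (rule vector_space_pscale)
  interpret V: vector_space s by fact
  show ?thesis
  proof unfold_locales
    fix u v c
    show "lin_ext s g (u + v) = lin_ext s g u + lin_ext s g v"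
      unfolding lin_ext_def by (rule setsum_keys_plus_distrib) (simp_all add: V.scale_left_distrib)
    \<comment> \<open>For \<open>c = 0\<close> the support shrinks, so the sum is taken over the
      keys of \<open>u\<close>, where the extra terms vanish.\<close>
    have "lin_ext s g (pscale c u) = (\<Sum>x\<in>Poly_Mapping.keys u. s (Poly_Mapping.lookup (pscale c u) x) (g x))"
      unfolding lin_ext_def
      by (rule sum.mono_neutral_left) (auto simp: in_keys_iff lookup_pscale)
    then show "lin_ext s g (pscale c u) = s c (lin_ext s g u)"
      by (simp add: lin_ext_def lookup_pscale V.scale_sum_right)
  qed
qed

lemma lin_ext_single:
  assumes "vector_space s" shows "lin_ext s g (Poly_Mapping.single x 1) = g x"
proof -
  interpret V: vector_space s by fact
  show ?thesis by (simp add: lin_ext_def)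
qed

text \<open>Carries the double sums over \<open>1..n\<close> in the kernel conditions to sums over
  the support of a formal combination.\<close>

lemma sum_sum_reindex:
  assumes "bij_betw h A S"
  shows "(\<Sum>i\<in>A. \<Sum>j\<in>A. g (h i) (h j)) = (\<Sum>i\<in>S. \<Sum>j\<in>S. g i j)"
proof -
  have "(\<Sum>j\<in>A. g i (h j)) = (\<Sum>j\<in>S. g i j)" for i
    by (rule sum.reindex_bij_betw[OF assms])
  then show ?thesis using sum.reindex_bij_betw[OF assms, of "\<lambda>i. \<Sum>j\<in>S. g i j"] by simp
qed

section \<open>From a dominating kernel to bounded GNS data\<close>

lemma admits_bounded_gns_data_if_kernel:
  fixes scaleA :: "complex \<Rightarrow> 'a::ring_1 \<Rightarrow> 'a" and star :: "'a \<Rightarrow> 'a" and Z :: "'a \<Rightarrow> complex"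
  assumes alg: "complex_star_algebra scaleA star"
    and Z_lin: "Vector_Spaces.linear scaleA (*) Z"
    and Z_herm: "hermitian_functional star Z"
    and L_herm: "\<And>x y. L x y = cnj (L y x)"
    and L_dom: "\<And>(n::nat) (c :: nat \<Rightarrow> complex) (x :: nat \<Rightarrow> 'a).
      complex_of_real (cmod (Z (\<Sum>i=1..n. \<Sum>j=1..n. scaleA (c i * cnj (c j)) (x i * star (x j)))))
      \<le> (\<Sum>i=1..n. \<Sum>j=1..n. c i * cnj (c j) * L (x i) (x j))"
    and L_bdd: "\<forall>a. \<exists>C::real. C > 0 \<and>
      (\<forall>(n::nat) (c :: nat \<Rightarrow> complex) (x :: nat \<Rightarrow> 'a).
        (\<Sum>i=1..n. \<Sum>j=1..n. c i * cnj (c j) * L (x i * star a) (x j * star a))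
        \<le> complex_of_real C * (\<Sum>i=1..n. \<Sum>j=1..n. c i * cnj (c j) * L (x i) (x j)))"
  shows "admits_bounded_gns_data scaleA star Z"
proof -
  have cv: "vector_space ((*) :: complex \<Rightarrow> complex \<Rightarrow> complex)"
    by unfold_locales (simp_all add: algebra_simps)
  interpret A: complex_star_algebra scaleA star by (rule alg)
  interpret Z: Vector_Spaces.linear scaleA "(*)" Z by (rule Z_lin)
  interpret P: vector_space "pscale :: complex \<Rightarrow> ('a \<Rightarrow>\<^sub>0 complex) \<Rightarrow> _" by (rule vector_space_pscale)
  let ?\<delta> = "\<lambda>x::'a. Poly_Mapping.single x (1::complex)"
  \<comment> \<open>\<open>\<sigma>\<close> evaluates a formal combination in the algebra, and
    \<open>b\<close> is the GNS form of \<open>Z\<close> pulled back along it; combinations with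
    equal value are indistinguishable for \<open>b\<close>.\<close>
  define \<sigma> where "\<sigma> = lin_ext scaleA (\<lambda>x::'a. x)"
  define T where "T a = lin_ext pscale (\<lambda>x. ?\<delta> (a * x))" for a
  define b where "b u v = Z (star (\<sigma> v) * \<sigma> u)" for u v
  \<comment> \<open>The hypotheses concern \<open>x i * star (x j)\<close> and right multiplication
    by \<open>star a\<close>, the GNS form \<open>star y * x\<close> and left multiplication by
    \<open>a\<close>. The stars inside \<open>L\<close>, with the arguments exchanged, reconcile the
    two.\<close>
  define q where "q u v = lin_ext (*) (\<lambda>x. \<Sum>y\<in>Poly_Mapping.keys v. cnj (Poly_Mapping.lookup v y) * L (star y) (star x)) u" for u v
  interpret S: Vector_Spaces.linear pscale scaleA \<sigma>
    unfolding \<sigma>_def by (rule linear_lin_ext[OF A.vector_space_axioms])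
  interpret T: Vector_Spaces.linear pscale pscale "T a" for a
    unfolding T_def by (rule linear_lin_ext[OF vector_space_pscale])
  interpret q: Vector_Spaces.linear pscale "(*)" "\<lambda>u. q u v" for v
    unfolding q_def by (rule linear_lin_ext[OF cv])
  have \<sigma>_single: "\<sigma> (?\<delta> x) = x" for x
    unfolding \<sigma>_def by (rule lin_ext_single[OF A.vector_space_axioms])
  have T_single: "T a (?\<delta> x) = ?\<delta> (a * x)" for a x
    unfolding T_def by (rule lin_ext_single[OF vector_space_pscale])
  have T_eq: "T a u = (\<Sum>x\<in>Poly_Mapping.keys u. pscale (Poly_Mapping.lookup u x) (?\<delta> (a * x)))" for a u
    by (simp add: T_def lin_ext_def)
  have q_single: "q (?\<delta> x) (?\<delta> y) = L (star y) (star x)" for x y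
    unfolding q_def lin_ext_single[OF cv] by simp
  have \<sigma>_T: "\<sigma> (T a u) = a * \<sigma> u" for a u
    unfolding T_eq S.sum S.scale \<sigma>_single
    by (simp add: \<sigma>_def lin_ext_def sum_distrib_left A.mult_scale_right)
  have T_mult: "T (a * a') u = T a (T a' u)" for a a' u
    unfolding T_eq[of a' u] T_eq[of "a * a'" u] T.sum T.scale T_single by (simp add: mult.assoc)
  have star_one: "star 1 = 1"
    using A.star_mult[of "star 1" 1] by (simp add: A.star_star)
  have star_\<sigma>: "star (\<sigma> u) = (\<Sum>x\<in>Poly_Mapping.keys u. scaleA (cnj (Poly_Mapping.lookup u x)) (star x))" for u
  proof -
    have star0: "star 0 = 0" using A.star_add[of 0 0] by simp
    have "star (\<Sum>x\<in>F. scaleA (Poly_Mapping.lookup u x) x) = (\<Sum>x\<in>F. scaleA (cnj (Poly_Mapping.lookup u x)) (star x))"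
      if "finite F" for F
      using that by (induction F) (auto simp: star0 A.star_add A.star_scale)
    then show ?thesis by (simp add: \<sigma>_def lin_ext_def)
  qed
  have b_herm: "hermitian_form pscale UNIV b"
  proof
    show "b x y = cnj (b y x)" for x y
      using Z_herm by (simp add: b_def hermitian_functional_def A.star_mult A.star_star flip: Z_herm[unfolded hermitian_functional_def, rule_format])
  qed (simp_all add: b_def S.add S.scale distrib_left Z.add Z.scale A.mult_scale_right)
  have q_herm: "hermitian_form pscale UNIV q"
  proof
    show "q u v = cnj (q v u)" for u v
    proof -
      have "q u v = (\<Sum>x\<in>Poly_Mapping.keys u. \<Sum>y\<in>Poly_Mapping.keys v. Poly_Mapping.lookup u x * (cnj (Poly_Mapping.lookup v y) * L (star y) (star x)))"
        by (simp add: q_def lin_ext_def sum_distrib_left)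
      also have "\<dots> = (\<Sum>y\<in>Poly_Mapping.keys v. \<Sum>x\<in>Poly_Mapping.keys u. Poly_Mapping.lookup u x * (cnj (Poly_Mapping.lookup v y) * L (star y) (star x)))"
        by (rule sum.swap)
      also have "\<dots> = cnj (q v u)"
        by (auto simp: q_def lin_ext_def sum_distrib_left L_herm[symmetric] intro!: sum.cong)
      finally show ?thesis .
    qed
  qed (simp_all add: q.add q.scale)
  interpret q: hermitian_form pscale UNIV q by (rule q_herm)
  have qT: "q (T a u) (T a u) = (\<Sum>x\<in>Poly_Mapping.keys u. \<Sum>y\<in>Poly_Mapping.keys u.
      cnj (Poly_Mapping.lookup u x) * Poly_Mapping.lookup u y * L (star x * star a) (star y * star a))" for a u
    unfolding T_eq by (subst q.form_sum_sum) (simp_all add: q_single A.star_mult)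
  \<comment> \<open>Lets \<open>qT\<close> with \<open>a = 1\<close> serve as the expansion of
    \<open>q u u\<close>.\<close>
  have "T 1 u = u" for u
    using poly_mapping_eq_sum_single[of u] by (simp add: T_eq)
  then have qq: "q u u = (\<Sum>x\<in>Poly_Mapping.keys u. \<Sum>y\<in>Poly_Mapping.keys u.
      cnj (Poly_Mapping.lookup u x) * Poly_Mapping.lookup u y * L (star x) (star y))" for u
    using qT[of 1 u] by (simp add: star_one)
  have bb: "b u u = Z (\<Sum>x\<in>Poly_Mapping.keys u. \<Sum>y\<in>Poly_Mapping.keys u.
      scaleA (cnj (Poly_Mapping.lookup u x) * Poly_Mapping.lookup u y) (star x * star (star y)))" for u
    unfolding b_def star_\<sigma>
    by (simp add: \<sigma>_def lin_ext_def sum_product A.mult_scale_left A.mult_scale_right A.star_star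
        mult.commute[of "cnj _"])
  have dom: "complex_of_real (cmod (b u u)) \<le> q u u" for u
  proof -
    obtain h where h: "bij_betw h {1..card (Poly_Mapping.keys u)} (Poly_Mapping.keys u)"
      using ex_bij_betw_nat_finite_1[OF finite_keys] by blast
    show ?thesis
      using L_dom[of "\<lambda>i. cnj (Poly_Mapping.lookup u (h i))" "\<lambda>i. star (h i)" "card (Poly_Mapping.keys u)"]
      unfolding bb qq complex_cnj_cnj
        sum_sum_reindex[OF h, of "\<lambda>x y. scaleA (cnj (Poly_Mapping.lookup u x) * Poly_Mapping.lookup u y) (star x * star (star y))"]
        sum_sum_reindex[OF h, of "\<lambda>x y. cnj (Poly_Mapping.lookup u x) * Poly_Mapping.lookup u y * L (star x) (star y)"] .
  qed
  have semi: "semi_inner pscale q"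
  proof
    \<comment> \<open>Positivity, including reality in the complex order, is inherited from the
      nonnegative number \<open>cmod (b u u)\<close> below \<open>q u u\<close>.\<close>
    fix u show "0 \<le> q u u"
      by (rule order_trans[OF _ dom]) (simp add: less_eq_complex_def)
  qed
  interpret q: semi_inner pscale q by (rule semi)
  obtain C where C_all: "\<forall>a. C a > 0 \<and> (\<forall>(n::nat) (c :: nat \<Rightarrow> complex) (x :: nat \<Rightarrow> 'a).
        (\<Sum>i=1..n. \<Sum>j=1..n. c i * cnj (c j) * L (x i * star a) (x j * star a))
        \<le> complex_of_real (C a) * (\<Sum>i=1..n. \<Sum>j=1..n. c i * cnj (c j) * L (x i) (x j)))"
    using choice[OF L_bdd] by (elim exE)
  then have C: "C a > 0" for a by blast
  have bdd: "(\<Sum>i=1..n. \<Sum>j=1..n. c i * cnj (c j) * L (x i * star a) (x j * star a))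
        \<le> complex_of_real (C a) * (\<Sum>i=1..n. \<Sum>j=1..n. c i * cnj (c j) * L (x i) (x j))"
    for a c x and n :: nat
    by (rule C_all[THEN spec, THEN conjunct2, THEN spec, THEN spec, THEN spec])
  have qC: "Re (q (T a u) (T a u)) \<le> C a * Re (q u u)" for a u
  proof -
    obtain h where h: "bij_betw h {1..card (Poly_Mapping.keys u)} (Poly_Mapping.keys u)"
      using ex_bij_betw_nat_finite_1[OF finite_keys] by blast
    have "q (T a u) (T a u) \<le> complex_of_real (C a) * q u u"
      using bdd[of "\<lambda>i. cnj (Poly_Mapping.lookup u (h i))" "\<lambda>i. star (h i)" a "card (Poly_Mapping.keys u)"]
      unfolding qT qq[of u] complex_cnj_cnj
        sum_sum_reindex[OF h, of "\<lambda>x y. cnj (Poly_Mapping.lookup u x) * Poly_Mapping.lookup u y * L (star x * star a) (star y * star a)"]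
        sum_sum_reindex[OF h, of "\<lambda>x y. cnj (Poly_Mapping.lookup u x) * Poly_Mapping.lookup u y * L (star x) (star y)"] .
    then show ?thesis by (simp add: less_eq_complex_def)
  qed
  \<comment> \<open>The maximum makes the constant equal for \<open>a\<close> and
    \<open>star a\<close>, as the minimality argument requires; enlarging it is harmless because
    \<open>q u u\<close> is nonnegative.\<close>
  define B where "B a = max (C a) (C (star a))" for a
  have B: "0 \<le> B a" "B (star a) = B a" for a
    using C[of a] by (auto simp: B_def A.star_star)
  have qB: "Re (q (T a u) (T a u)) \<le> B a * Re (q u u)" for a u
    by (rule order_trans[OF qC]) (simp add: B_def mult_right_mono flip: q.norm_sq)
  have maj: "krein_majorant pscale q b"
    using semi b_herm dom
    by (intro krein_majorant.intro krein_majorant_axioms.intro) (simp_all add: less_eq_complex_def)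
  have adj: "b (T a u) v = b u (T (star a) v)" for a u v
    by (simp add: b_def \<sigma>_T A.star_mult A.star_star mult.assoc)
  obtain r where r: "krein_majorant pscale r b" "\<And>a u. Re (r (T a u) (T a u)) \<le> B a * Re (r u u)"
    "\<And>u v. semi_inner.cip r (b u) (b v) = r u v"
    using isometric_krein_majorant_exists[where T = T and B = B and st = star, OF maj qB adj B(2) B(1)] by blast
  interpret r: krein_majorant pscale r b by (rule r)
  have span: "P.span (range (\<lambda>a. T a (?\<delta> 1))) = UNIV"
  proof -
    have "u \<in> P.span (range (\<lambda>a. T a (?\<delta> 1)))" for u
      by (subst poly_mapping_eq_sum_single, intro P.span_sum P.span_scale P.span_base)
        (simp add: T_single)
    then show ?thesis by blast
  qed
  interpret I: intertwining_operators pscale r b scaleA star T "\<lambda>a. sqrt (B a)" "?\<delta> 1"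
  proof
    show "form_norm r (T a u) \<le> sqrt (B a) * form_norm r u" for a u
      using r(2)[of a u] by (simp add: form_norm_def real_sqrt_mult[symmetric])
  qed (simp_all add: r(3) T.add T.scale adj T_mult span b_def \<sigma>_T distrib_left distrib_right Z.add Z.scale
      A.mult_scale_left A.mult_scale_right A.star_mult A.star_star mult.assoc)
  show ?thesis
    by (rule admits_bounded_gns_dataI[OF I.bounded_gns_data]) (simp add: b_def \<sigma>_T \<sigma>_single star_one)
qed

section \<open>The kernel of bounded GNS data\<close>

context bounded_gns_data begin

lemma form_norm_J: "x \<in> K \<Longrightarrow> form_norm ip (J x) = form_norm ip x"
  by (simp add: form_norm_def J_selfadjoint J_closed J_involution)

lemma kf_bound:
  assumes "x \<in> K" shows "cmod (kf x x) \<le> Re (ip x x)"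
  using pos.cauchy_schwarz[OF J_closed[OF assms] assms] pos.ip_real[OF assms] assms
  by (simp add: kf_eq form_norm_J power2_eq_square)

lemma kf_rep: "x \<in> D \<Longrightarrow> y \<in> D \<Longrightarrow> kf (rep a x) y = kf x (rep (star a) y)"
  using krein_adjoint_rel_rep[of y a "rep (star a) y"] by (simp add: krein_adjoint_rel_def)

lemma rep_sum:
  assumes "finite S" "\<And>i. i \<in> S \<Longrightarrow> f i \<in> D"
  shows "rep a (\<Sum>i\<in>S. scale (c i) (f i)) = (\<Sum>i\<in>S. scale (c i) (rep a (f i)))"
proof -
  have 0: "rep a 0 = 0" using rep_op_add[of 0 0] D_ops(3) by simp
  have "F \<subseteq> S \<Longrightarrow> rep a (\<Sum>i\<in>F. scale (c i) (f i)) = (\<Sum>i\<in>F. scale (c i) (rep a (f i)))" if "finite F" for F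
    using that
  proof (induction F)
    case (insert i F)
    have "(\<Sum>i\<in>F. scale (c i) (f i)) \<in> D"
      using assms insert by (auto intro!: subspace_sum subspace_scale subspace_D)
    then show ?case using insert assms by (simp add: rep_op_add rep_op_scale D_ops)
  qed (simp add: 0)
  then show ?thesis using assms(1) by blast
qed

definition gns_kernel :: "'a \<Rightarrow> 'a \<Rightarrow> complex" where
  "gns_kernel x y = ip (rep (star y) \<Omega>) (rep (star x) \<Omega>)"

lemma Z_mult_star: "Z (x * star y) = kf (rep (star y) \<Omega>) (rep (star x) \<Omega>)"
  by (simp add: Z_eq rep_mult kf_rep \<Omega>_in_D rep_\<Omega>)

lemma gns_kernel_sum:
  "(\<Sum>i=1..n. \<Sum>j=1..n. c i * cnj (c j) * gns_kernel (x i) (x j))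
    = ip (\<Sum>i=1..n. scale (cnj (c i)) (rep (star (x i)) \<Omega>))
        (\<Sum>i=1..n. scale (cnj (c i)) (rep (star (x i)) \<Omega>))" for n :: nat
  by (subst pos.form_sum_sum) (simp_all add: rep_\<Omega> gns_kernel_def)

lemma gns_kernel_positive_definite: "positive_definite_kernel gns_kernel"
  unfolding positive_definite_kernel_def
proof (intro conjI allI)
  show "gns_kernel x y = cnj (gns_kernel y x)" for x y
    unfolding gns_kernel_def by (rule pos.form_cnj) (simp_all add: rep_\<Omega>)
  fix n :: nat and c :: "nat \<Rightarrow> complex" and x :: "nat \<Rightarrow> 'a"
  have "(\<Sum>i=1..n. \<Sum>j=1..n. gns_kernel (x i) (x j) * c j * cnj (c i))
    = ip (\<Sum>i=1..n. scale (c i) (rep (star (x i)) \<Omega>))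
        (\<Sum>i=1..n. scale (c i) (rep (star (x i)) \<Omega>))"
    using gns_kernel_sum[where c = "\<lambda>i. cnj (c i)"] by (simp add: mult_ac)
  also have "0 \<le> \<dots>"
    by (intro pos.ip_nonneg subspace_sum subspace_scale subspace_K rep_\<Omega>)
  finally show "0 \<le> (\<Sum>i=1..n. \<Sum>j=1..n. gns_kernel (x i) (x j) * c j * cnj (c i))" .
qed

lemma gns_kernel_dominates:
  fixes n :: nat
  assumes "Vector_Spaces.linear scaleA (*) Z"
  shows "complex_of_real (cmod (Z (\<Sum>i=1..n. \<Sum>j=1..n. scaleA (c i * cnj (c j)) (x i * star (x j)))))
    \<le> (\<Sum>i=1..n. \<Sum>j=1..n. c i * cnj (c j) * gns_kernel (x i) (x j))"
proof -
  interpret Z: Vector_Spaces.linear scaleA "(*)" Z by fact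
  define w where "w = (\<Sum>i=1..n. scale (cnj (c i)) (rep (star (x i)) \<Omega>))"
  have w: "w \<in> K" unfolding w_def by (intro subspace_sum subspace_scale subspace_K rep_\<Omega>)
  have "Z (\<Sum>i=1..n. \<Sum>j=1..n. scaleA (c i * cnj (c j)) (x i * star (x j))) = kf w w"
    unfolding w_def
    by (subst form_sum_sum) (simp_all add: rep_\<Omega> Z.sum Z.scale Z_mult_star)
  then show ?thesis
    using kf_bound[OF w] pos.ip_nonneg[OF w]
    unfolding gns_kernel_sum w_def[symmetric] by (simp add: less_eq_complex_def)
qed

lemma gns_kernel_bounded:
  "\<exists>C::real. C > 0 \<and> (\<forall>(n::nat) (c :: nat \<Rightarrow> complex) (x :: nat \<Rightarrow> 'a).
    (\<Sum>i=1..n. \<Sum>j=1..n. c i * cnj (c j) * gns_kernel (x i * star a) (x j * star a))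
    \<le> complex_of_real C * (\<Sum>i=1..n. \<Sum>j=1..n. c i * cnj (c j) * gns_kernel (x i) (x j)))"
proof -
  obtain C where C: "\<And>x. x \<in> D \<Longrightarrow> form_norm ip (rep a x) \<le> C * form_norm ip x"
    using rep_bounded[of a] by (auto simp: bounded_operator_def)
  show ?thesis
  proof (intro exI[of _ "C\<^sup>2 + 1"] conjI allI)
    show "0 < C\<^sup>2 + 1" by (simp add: add_nonneg_pos)
    fix n :: nat and c :: "nat \<Rightarrow> complex" and x :: "nat \<Rightarrow> 'a"
    define w where "w = (\<Sum>i=1..n. scale (cnj (c i)) (rep (star (x i)) \<Omega>))"
    have w: "w \<in> D" unfolding w_def by (intro subspace_sum subspace_scale subspace_D rep_\<Omega>)
    have wK: "w \<in> K" "rep a w \<in> K" using w rep_closed DK by auto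
    have "(\<Sum>i=1..n. scale (cnj (c i)) (rep (star (x i * star a)) \<Omega>)) = rep a w"
      unfolding w_def by (subst rep_sum) (simp_all add: rep_\<Omega> alg.star_mult alg.star_star rep_mult \<Omega>_in_D)
    then have "(\<Sum>i=1..n. \<Sum>j=1..n. c i * cnj (c j) * gns_kernel (x i * star a) (x j * star a))
        = ip (rep a w) (rep a w)"
      unfolding gns_kernel_sum by simp
    also have "\<dots> \<le> complex_of_real (C\<^sup>2 + 1) * ip w w"
    proof -
      have "(form_norm ip (rep a w))\<^sup>2 \<le> (C * form_norm ip w)\<^sup>2"
        using C[OF w] pos.ip_real(2)[OF wK(2)] by (intro power_mono)
      also have "\<dots> \<le> (C\<^sup>2 + 1) * (form_norm ip w)\<^sup>2"
        by (simp add: power_mult_distrib algebra_simps)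
      finally have "complex_of_real ((form_norm ip (rep a w))\<^sup>2)
          \<le> complex_of_real ((C\<^sup>2 + 1) * (form_norm ip w)\<^sup>2)"
        by (simp add: less_eq_complex_def)
      then show ?thesis unfolding pos.ip_real(1)[OF wK(1)] pos.ip_real(1)[OF wK(2)] of_real_mult .
    qed
    also have "ip w w = (\<Sum>i=1..n. \<Sum>j=1..n. c i * cnj (c j) * gns_kernel (x i) (x j))"
      unfolding gns_kernel_sum w_def ..
    finally show "(\<Sum>i=1..n. \<Sum>j=1..n. c i * cnj (c j) * gns_kernel (x i * star a) (x j * star a))
      \<le> complex_of_real (C\<^sup>2 + 1) * (\<Sum>i=1..n. \<Sum>j=1..n. c i * cnj (c j) * gns_kernel (x i) (x j))" .
  qed
qed

end

theorem theorem6p4: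
  fixes scaleA :: "complex \<Rightarrow> 'a::ring_1 \<Rightarrow> 'a"
    and star :: "'a \<Rightarrow> 'a"
    and Z :: "'a \<Rightarrow> complex"
  assumes "complex_star_algebra scaleA star"
    and "Vector_Spaces.linear scaleA (*) Z"
    and "hermitian_functional star Z"
    and "Z 1 = 1"
  shows "admits_bounded_gns_data scaleA star Z \<longleftrightarrow>
    (\<exists>L :: 'a \<Rightarrow> 'a \<Rightarrow> complex.
       positive_definite_kernel L \<and>
       (\<forall>(n::nat) (c :: nat \<Rightarrow> complex) (x :: nat \<Rightarrow> 'a).
          complex_of_real (cmod (Z (\<Sum>i=1..n. \<Sum>j=1..n. scaleA (c i * cnj (c j)) (x i * star (x j)))))
          \<le> (\<Sum>i=1..n. \<Sum>j=1..n. c i * cnj (c j) * L (x i) (x j))) \<and>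
       (\<forall>a. \<exists>C::real. C > 0 \<and>
          (\<forall>(n::nat) (c :: nat \<Rightarrow> complex) (x :: nat \<Rightarrow> 'a).
             (\<Sum>i=1..n. \<Sum>j=1..n. c i * cnj (c j) * L (x i * star a) (x j * star a))
             \<le> complex_of_real C * (\<Sum>i=1..n. \<Sum>j=1..n. c i * cnj (c j) * L (x i) (x j)))))"
    (is "?lhs \<longleftrightarrow> ?rhs")
proof
  assume ?lhs
  then obtain K kf ip J D rep \<Omega> where
    "bounded_gns_data scaleA star scale_fun (K :: ('a \<Rightarrow> complex) set) kf ip J D rep Z \<Omega>"
    unfolding admits_bounded_gns_data_def by blast
  then interpret bounded_gns_data scaleA star scale_fun K kf ip J D rep Z \<Omega> .
  show ?rhs
    using gns_kernel_positive_definite gns_kernel_dominates[OF assms(2)] gns_kernel_bounded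
    by (intro exI[of _ gns_kernel] conjI allI)
next
  assume ?rhs
  then show ?lhs
    using admits_bounded_gns_data_if_kernel[OF assms(1-3)]
    unfolding positive_definite_kernel_def by blast
qed

end
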